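(* Let $V\subset\mathbb{R}^d$ be an at most countable set of isolated points, with lattice set $\Lambda(V)$, and assume that every $\mu\in\mathbb{N}_0^d$ with $|\mu|\in\{1,2,3\}$ belongs to $\Lambda(V)$. Let $$D=\sum_{1\le i,j\le d}A_{i,j}\triangle_i\nabla_j+\sum_{i=1}^dB_i\triangle_i$$ be a second order difference operator such that the ideal $\mathfrak{I}(V)$ is $D$-invariant. Then the following conditions are equivalent: (i) The equation $Du=\lambda u$ is admissible on $V$. (ii) The coefficients $B_i$ are polynomials of degree at most $1$ and the coefficients $A_{i,j}$ are polynomials of degree at most $2$, and there are constants $a,b$ such that $$B_i=bx_i \mod \Pi^d_0\quad (1\le i\le d),$$ $$A_{i,i}=ax_i^2\mod \Pi^d_1\quad (1\le i\le d),$$ $$A_{i,j}+A_{j,i}=2ax_ix_j\mod \Pi^d_1\quad (1\le i\ne j\le d);$$ moreover the eigenvalues $\lambda_k$ are given by $\lambda_k=k(ka-a+b)$ and they are distinct (for the $k\in\mathbb{N}_0$ with $r_k>0$).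
   Context: $\{e_1,\dots,e_d\}$ is the standard basis of $\mathbb{R}^d$; $\triangle_if(x)=f(x+e_i)-f(x)$, $\nabla_if(x)=f(x)-f(x-e_i)$. For $\mu\in\mathbb{N}_0^d$, $x^\mu=x_1^{\mu_1}\cdots x_d^{\mu_d}$ and $|\mu|=\mu_1+\dots+\mu_d$. $\Pi^d_n$ is the space of real polynomials in $x_1,\dots,x_d$ of total degree at most $n$. $\mathfrak{I}(V)=\{p\in\mathbb{R}[x_1,\dots,x_d]:p(x)=0\text{ for all }x\in V\}$ and $\mathbb{R}[V]=\mathbb{R}[x_1,\dots,x_d]/\mathfrak{I}(V)$. $\Lambda(V)\subset\mathbb{N}_0^d$ is a fixed set of multi-indices such that every element of $\mathbb{R}[V]$ is uniquely of the form $\sum_{\mu\in\Lambda(V)}c_\mu x^\mu$ (finite sum), compatibly with the degree: for each $n$ the monomials $x^\mu$ with $\mu\in\Lambda(V)$, $|\mu|\le n$, form a basis of the image of $\Pi^d_n$ in $\mathbb{R}[V]$. Put $\Lambda_k(V)=\{\mu\in\Lambda(V):|\mu|=k\}$ and $r_k=|\Lambda_k(V)|$. The $A_{i,j}$, $B_i$ are real functions of $x$. The ideal $\mathfrak I(V)$ being $D$-invariant means $D(\mathfrak{I}(V))\subset\mathfrak{I}(V)$, so that $D$ acts on $\mathbb{R}[V]$ (it is understood that $D$ sends polynomials to functions which on $V$ coincide with polynomials). All identities, including "is a polynomial of degree at most $n$" and "$\mathrm{mod}\ \Pi^d_n$", are understood in $\mathbb{R}[V]$ (i.e. for functions on $V$),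 with $\Pi^d_n$ standing for its image there. The equation $Du=\lambda u$ is called admissible on $V$ if for every $k\in\mathbb{N}_0$ there is a number $\lambda_k$ such that $Du=\lambda_ku$ has $r_k$ linearly independent polynomial solutions in $\mathbb{R}[V]$ (of degree $k$) and has no nontrivial solutions among polynomials of degree less than $k$. Throughout $\lambda_0=0$ (equivalently, $D$ has no term $C\,\mathrm{Id}$). *)

theory Defs
  imports "HOL-Analysis.Analysis" "HOL-Library.Poly_Mapping"
begin

text \<open>The index type \<open>'d\<close> plays the role of \<open>{1, \<dots>, d}\<close>.
  Real polynomials in the variables \<open>x\<^sub>i\<close> are the elements of the monoid
  algebra of the multi-indices, with the library's ring structure on
  \<^typ>\<open>('d \<Rightarrow>\<^sub>0 nat) \<Rightarrow>\<^sub>0 real\<close>.\<close>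

type_synonym 'd multi_index = "'d \<Rightarrow>\<^sub>0 nat"
type_synonym 'd polynomial = "'d multi_index \<Rightarrow>\<^sub>0 real"

definition mdeg :: "('d::finite) multi_index \<Rightarrow> nat"
  where "mdeg \<mu> = (\<Sum>i\<in>UNIV. Poly_Mapping.lookup \<mu> i)"

definition mpow :: "real ^ ('d::finite) \<Rightarrow> 'd multi_index \<Rightarrow> real"
  where "mpow x \<mu> = (\<Prod>i\<in>UNIV. (x $ i) ^ Poly_Mapping.lookup \<mu> i)"

definition poly_fun :: "('d::finite) polynomial \<Rightarrow> real ^ 'd \<Rightarrow> real"
  where "poly_fun p x = (\<Sum>\<mu>\<in>Poly_Mapping.keys p. Poly_Mapping.lookup p \<mu> * mpow x \<mu>)"

definition Pi_le :: "nat \<Rightarrow> ('d::finite) polynomial set"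
  where "Pi_le n = {p. \<forall>\<mu>\<in>Poly_Mapping.keys p. mdeg \<mu> \<le> n}"

definition vanishing_ideal :: "(real ^ ('d::finite)) set \<Rightarrow> 'd polynomial set"
  where "vanishing_ideal V = {p. \<forall>x\<in>V. poly_fun p x = 0}"

text \<open>Elements of the quotient ring \<open>\<real>[V]\<close> are handled through representatives:
  two polynomials are equal in \<open>\<real>[V]\<close> iff their difference lies in
  \<^term>\<open>vanishing_ideal V\<close>, that is, iff they agree as functions on \<open>V\<close>.
  A polynomial whose keys lie in a set \<open>M\<close> is the same as a finite linear combination
  of the monomials with exponent in \<open>M\<close>.\<close>

definition lattice_set :: "(real ^ ('d::finite)) set \<Rightarrow> 'd multi_index set \<Rightarrow> bool"
  where "lattice_set V \<Lambda> \<longleftrightarrow>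
    (\<forall>p. \<exists>!c. Poly_Mapping.keys c \<subseteq> \<Lambda> \<and> p - c \<in> vanishing_ideal V) \<and>
    (\<forall>n. \<forall>p\<in>Pi_le n. \<exists>!c. Poly_Mapping.keys c \<subseteq> {\<mu> \<in> \<Lambda>. mdeg \<mu> \<le> n} \<and> p - c \<in> vanishing_ideal V)"

definition lattice_count :: "('d::finite) multi_index set \<Rightarrow> nat \<Rightarrow> nat"
  where "lattice_count \<Lambda> k = card {\<mu> \<in> \<Lambda>. mdeg \<mu> = k}"

text \<open>The degree of a class in \<open>\<real>[V]\<close> is the least degree of a representative; the zero
  class gets degree \<open>0\<close>.\<close>

definition class_degree :: "(real ^ ('d::finite)) set \<Rightarrow> 'd polynomial \<Rightarrow> nat"
  where "class_degree V p = (LEAST n. \<exists>q\<in>Pi_le n. p - q \<in> vanishing_ideal V)"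

text \<open>Linear independence in \<open>\<real>[V]\<close> of the classes of \<open>u 0, \<dots>, u (r - 1)\<close>;
  \<^term>\<open>Poly_Mapping.single 0 c\<close> is the constant polynomial \<open>c\<close>.\<close>

definition lin_indep_mod ::
    "(real ^ ('d::finite)) set \<Rightarrow> nat \<Rightarrow> (nat \<Rightarrow> 'd polynomial) \<Rightarrow> bool"
  where "lin_indep_mod V r u \<longleftrightarrow>
    (\<forall>c :: nat \<Rightarrow> real.
      (\<Sum>i<r. Poly_Mapping.single 0 (c i) * u i) \<in> vanishing_ideal V \<longrightarrow> (\<forall>i<r. c i = 0))"

text \<open>\<open>f\<close> coincides on \<open>V\<close> with a polynomial of degree at most \<open>n\<close>.\<close>

definition poly_on :: "(real ^ ('d::finite)) set \<Rightarrow> nat \<Rightarrow> (real ^ 'd \<Rightarrow> real) \<Rightarrow> bool"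
  where "poly_on V n f \<longleftrightarrow> (\<exists>p\<in>Pi_le n. \<forall>x\<in>V. f x = poly_fun p x)"

definition cong_on ::
    "(real ^ ('d::finite)) set \<Rightarrow> nat \<Rightarrow> (real ^ 'd \<Rightarrow> real) \<Rightarrow> (real ^ 'd \<Rightarrow> real) \<Rightarrow> bool"
  where "cong_on V n f g \<longleftrightarrow> poly_on V n (\<lambda>x. f x - g x)"

definition fwd_diff :: "'d \<Rightarrow> (real ^ ('d::finite) \<Rightarrow> real) \<Rightarrow> real ^ 'd \<Rightarrow> real"
  where "fwd_diff i f x = f (x + axis i 1) - f x"

definition bwd_diff :: "'d \<Rightarrow> (real ^ ('d::finite) \<Rightarrow> real) \<Rightarrow> real ^ 'd \<Rightarrow> real"
  where "bwd_diff i f x = f x - f (x - axis i 1)"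

definition diff_op ::
    "('d \<Rightarrow> 'd \<Rightarrow> real ^ 'd \<Rightarrow> real) \<Rightarrow> ('d \<Rightarrow> real ^ 'd \<Rightarrow> real) \<Rightarrow>
     (real ^ ('d::finite) \<Rightarrow> real) \<Rightarrow> real ^ 'd \<Rightarrow> real"
  where "diff_op A B f x =
    (\<Sum>i\<in>UNIV. \<Sum>j\<in>UNIV. A i j x * fwd_diff i (bwd_diff j f) x) +
    (\<Sum>i\<in>UNIV. B i x * fwd_diff i f x)"

text \<open>\<open>D\<close> acts on \<open>\<real>[V]\<close>: it sends polynomials to functions that are polynomial
  on \<open>V\<close>, and it maps the vanishing ideal into itself.\<close>

definition ideal_invariant ::
    "(real ^ ('d::finite)) set \<Rightarrow> ((real ^ 'd \<Rightarrow> real) \<Rightarrow> real ^ 'd \<Rightarrow> real) \<Rightarrow> bool"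
  where "ideal_invariant V D \<longleftrightarrow>
    (\<forall>p. \<exists>q. \<forall>x\<in>V. D (poly_fun p) x = poly_fun q x) \<and>
    (\<forall>p\<in>vanishing_ideal V. \<exists>q\<in>vanishing_ideal V. \<forall>x\<in>V. D (poly_fun p) x = poly_fun q x)"

definition solution_on ::
    "(real ^ ('d::finite)) set \<Rightarrow> ((real ^ 'd \<Rightarrow> real) \<Rightarrow> real ^ 'd \<Rightarrow> real) \<Rightarrow> real \<Rightarrow>
     'd polynomial \<Rightarrow> bool"
  where "solution_on V D lam u \<longleftrightarrow> (\<forall>x\<in>V. D (poly_fun u) x = lam * poly_fun u x)"

definition admissible_at ::
    "(real ^ ('d::finite)) set \<Rightarrow> 'd multi_index set \<Rightarrow>
     ((real ^ 'd \<Rightarrow> real) \<Rightarrow> real ^ 'd \<Rightarrow> real) \<Rightarrow> nat \<Rightarrow> real \<Rightarrow> bool"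
  where "admissible_at V \<Lambda> D k lam \<longleftrightarrow>
    (\<exists>u. (\<forall>i<lattice_count \<Lambda> k. solution_on V D lam (u i) \<and> class_degree V (u i) = k) \<and>
         lin_indep_mod V (lattice_count \<Lambda> k) u) \<and>
    (\<forall>u. solution_on V D lam u \<and> class_degree V u < k \<longrightarrow> u \<in> vanishing_ideal V)"

definition admissible ::
    "(real ^ ('d::finite)) set \<Rightarrow> 'd multi_index set \<Rightarrow>
     ((real ^ 'd \<Rightarrow> real) \<Rightarrow> real ^ 'd \<Rightarrow> real) \<Rightarrow> bool"
  where "admissible V \<Lambda> D \<longleftrightarrow> (\<forall>k. \<exists>lam. admissible_at V \<Lambda> D k lam)"

definition coeff_conditions ::
    "(real ^ ('d::finite)) set \<Rightarrow> ('d \<Rightarrow> 'd \<Rightarrow> real ^ 'd \<Rightarrow> real) \<Rightarrow>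
     ('d \<Rightarrow> real ^ 'd \<Rightarrow> real) \<Rightarrow> real \<Rightarrow> real \<Rightarrow> bool"
  where "coeff_conditions V A B a b \<longleftrightarrow>
    (\<forall>i. poly_on V 1 (B i)) \<and>
    (\<forall>i j. poly_on V 2 (A i j)) \<and>
    (\<forall>i. cong_on V 0 (B i) (\<lambda>x. b * x $ i)) \<and>
    (\<forall>i. cong_on V 1 (A i i) (\<lambda>x. a * (x $ i)\<^sup>2)) \<and>
    (\<forall>i j. i \<noteq> j \<longrightarrow> cong_on V 1 (\<lambda>x. A i j x + A j i x) (\<lambda>x. 2 * a * (x $ i) * (x $ j)))"

definition eigenvalue :: "real \<Rightarrow> real \<Rightarrow> nat \<Rightarrow> real"
  where "eigenvalue a b k = real k * (real k * a - a + b)"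

end

theory Submission
  imports Defs
begin

text \<open>
  Write \<open>\<Pi>\<^sub>n\<close> for the polynomial functions on \<open>V\<close> of degree at most \<open>n\<close>, with \<open>\<Pi>\<^sub>n = 0\<close> for negative
  \<open>n\<close>, and \<open>r\<^sub>k\<close> for \<open>lattice_count \<Lambda> k\<close>, the dimension of \<open>\<Pi>\<^sub>k\<close> modulo \<open>\<Pi>\<^sub>k\<^sub>-\<^sub>1\<close>.
  Both sides of the equivalence are compared with a third condition: \<open>D\<close> acts on each layer
  \<open>\<Pi>\<^sub>k / \<Pi>\<^sub>k\<^sub>-\<^sub>1\<close> as multiplication by a scalar \<open>e\<^sub>k\<close>, that is, \<open>D f = e\<^sub>k f\<close> modulo \<open>\<Pi>\<^sub>k\<^sub>-\<^sub>1\<close> for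
  all \<open>f\<close> in \<open>\<Pi>\<^sub>k\<close> (\<open>acts_on_layer\<close>).

  \<^item> The conditions on the coefficients imply this with \<open>e\<^sub>k = k (k a - a + b)\<close>
    (\<open>coeff_conditions_imp_acts_on_layer\<close>). The proof is by induction on the degree:
    \<open>diff_op_coord\<close> computes \<open>D (x\<^sub>l f)\<close> from \<open>D f\<close> and differences of \<open>f\<close>, and the Euler
    relation \<open>\<Sum>\<^sub>j x\<^sub>j \<triangle>\<^sub>j f = k f\<close> modulo \<open>\<Pi>\<^sub>k\<^sub>-\<^sub>1\<close> (\<open>deg_lt_euler\<close>) evaluates the leading part.
  \<^item> Conversely, a scalar action on the layers of degrees 1, 2 and 3 forces these conditions
    (\<open>acts_on_layer_imp_coeff_conditions\<close>). Applying \<open>D\<close> to \<open>x\<^sub>i\<close> and \<open>x\<^sub>i x\<^sub>j\<close> gives \<open>B\<^sub>i\<close> and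
    \<open>A\<^sub>i\<^sub>j + A\<^sub>j\<^sub>i\<close>. Applying it to \<open>x\<^sub>i\<^sup>2 x\<^sub>j\<close> gives \<open>A\<^sub>i\<^sub>j - A\<^sub>j\<^sub>i = c x\<^sub>i\<^sup>2 x\<^sub>j\<close> modulo \<open>\<Pi>\<^sub>2\<close> with
    a constant \<open>c\<close> that does not depend on \<open>i\<close> and \<open>j\<close>. The left-hand side is antisymmetric, so
    \<open>c (x\<^sub>i\<^sup>2 x\<^sub>j + x\<^sub>j\<^sup>2 x\<^sub>i)\<close> lies in \<open>\<Pi>\<^sub>2\<close>; as the cubic monomials belong to \<open>\<Lambda>\<close>, this
    forces \<open>c = 0\<close>, and each \<open>A\<^sub>i\<^sub>j\<close> has degree at most 2.
  \<^item> Admissibility implies scalar action (\<open>admissible_imp_acts_on_layer\<close>): solutions of degree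
    \<open>k\<close> stay independent modulo \<open>\<Pi>\<^sub>k\<^sub>-\<^sub>1\<close>, since a combination in \<open>\<Pi>\<^sub>k\<^sub>-\<^sub>1\<close> is a solution of lower
    degree and hence zero; there are \<open>r\<^sub>k\<close> of them, so they span the layer.
  \<^item> If \<open>D\<close> acts by scalars \<open>e\<^sub>k\<close> that are distinct over \<open>r\<^sub>k > 0\<close>, then \<open>D - e\<^sub>k\<close> is bijective on
    \<open>\<Pi>\<^sub>k\<^sub>-\<^sub>1\<close> (\<open>shifted_operator_solvable\<close>, \<open>solution_on_unique\<close>), so each monomial \<open>x\<^sup>\<mu>\<close> with
    \<open>\<mu> \<in> \<Lambda>\<close> and \<open>|\<mu>| = k\<close> can be corrected by lower terms to a solution (\<open>admissible_atI\<close>).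
    Conversely, admissibility identifies its eigenvalues with the \<open>e\<^sub>k\<close>
    (\<open>admissible_at_eigenvalue\<close>), and a coincidence \<open>e\<^sub>j = e\<^sub>k\<close> with \<open>j < k\<close> would produce a
    nontrivial solution of degree less than \<open>k\<close>.
\<close>

section \<open>Polynomial functions of bounded degree\<close>

text \<open>\<open>deg_lt n f\<close> says that \<open>f\<close> is a polynomial function on the whole space of degree strictly
  less than \<open>n\<close>. The strict bound makes \<open>deg_lt 0\<close> the zero function, so that the degree 0 layer
  needs no separate treatment. The rules build polynomials by multiplication with coordinates;
  the agreement with the polynomials of the monoid algebra is \<open>deg_lt_poly_fun\<close> and
  \<open>deg_lt_imp_poly_fun\<close>.\<close>

inductive deg_lt :: "nat \<Rightarrow> (real ^ ('d::finite) \<Rightarrow> real) \<Rightarrow> bool" where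
  deg_lt_zero: "deg_lt n (\<lambda>x. 0)"
| deg_lt_add: "deg_lt n f \<Longrightarrow> deg_lt n g \<Longrightarrow> deg_lt n (\<lambda>x. f x + g x)"
| deg_lt_const: "deg_lt (Suc n) (\<lambda>x. c)"
| deg_lt_coord: "deg_lt n f \<Longrightarrow> deg_lt (Suc n) (\<lambda>x. x $ l * f x)"

lemma deg_lt_0D: "deg_lt n f \<Longrightarrow> n = 0 \<Longrightarrow> f = (\<lambda>x. 0)"
  by (induction rule: deg_lt.induct) auto

lemma deg_lt_Suc: "deg_lt n f \<Longrightarrow> deg_lt (Suc n) f"
  by (induction rule: deg_lt.induct) (auto intro: deg_lt.intros)

lemma deg_lt_mono: "deg_lt n f \<Longrightarrow> n \<le> m \<Longrightarrow> deg_lt m f"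
  by (rotate_tac, induction rule: dec_induct) (auto intro: deg_lt_Suc)

lemma deg_lt_cmult: "deg_lt n f \<Longrightarrow> deg_lt n (\<lambda>x. c * f x)"
proof (induction rule: deg_lt.induct)
  case (deg_lt_coord n f l)
  have "(\<lambda>x. c * (x $ l * f x)) = (\<lambda>x. x $ l * (c * f x))" by (simp add: mult_ac)
  then show ?case using deg_lt.deg_lt_coord[OF deg_lt_coord.IH] by simp
qed (auto simp: distrib_left intro: deg_lt.intros)

text \<open>Degrees below \<open>n\<close> and \<open>m\<close> multiply to a degree below \<open>n + m - 1\<close>; the disjuncts \<open>n = 0\<close> and
  \<open>m = 0\<close> cover a zero factor, for which every bound holds.\<close>

lemma deg_lt_mult:
  assumes "deg_lt n f" "deg_lt m g" "n = 0 \<or> m = 0 \<or> n + m \<le> Suc r"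
  shows "deg_lt r (\<lambda>x. f x * g x)"
proof -
  have *: "n = 0 \<or> deg_lt (n - 1 + m) (\<lambda>x. f x * g x)"
    using assms(1)
  proof (induction rule: deg_lt.induct)
    case (deg_lt_add n f g)
    then show ?case by (auto simp: distrib_right intro: deg_lt.intros)
  next
    case (deg_lt_const n c)
    then show ?case
      using deg_lt_mono[OF deg_lt_cmult[OF assms(2), of c], of "n + m"] by simp
  next
    case (deg_lt_coord n f l)
    show ?case
    proof (cases n)
      case 0
      then have "f = (\<lambda>x. 0)" using deg_lt_0D deg_lt_coord.hyps by blast
      then show ?thesis by (auto intro: deg_lt_zero)
    next
      case (Suc k)
      then have "deg_lt (k + m) (\<lambda>x. f x * g x)" using deg_lt_coord.IH by simp
      from deg_lt.deg_lt_coord[OF this, of l] show ?thesis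
        using Suc by (simp add: mult.assoc)
    qed
  qed (auto intro: deg_lt.intros)
  show ?thesis
  proof (cases "n = 0 \<or> m = 0")
    case True
    then show ?thesis using deg_lt_0D[OF assms(1)] deg_lt_0D[OF assms(2)]
      by (auto intro: deg_lt_zero)
  next
    case False
    then have "deg_lt (n - 1 + m) (\<lambda>x. f x * g x)" "n - 1 + m \<le> r" using * assms(3) by auto
    then show ?thesis by (rule deg_lt_mono)
  qed
qed

lemma deg_lt_sum:
  "(\<And>i. i \<in> I \<Longrightarrow> deg_lt n (f i)) \<Longrightarrow> deg_lt n (\<lambda>x. \<Sum>i\<in>I. f i x)"
  by (induction I rule: infinite_finite_induct) (auto intro: deg_lt.intros)

lemma fwd_diff_coord:
  "fwd_diff i (\<lambda>x. x $ l * f x) x = x $ l * fwd_diff i f x + of_bool (i = l) * (f x + fwd_diff i f x)"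
  by (auto simp: fwd_diff_def axis_def algebra_simps)

lemma bwd_diff_coord:
  "bwd_diff i (\<lambda>x. x $ l * f x) x = x $ l * bwd_diff i f x + of_bool (i = l) * (f x - bwd_diff i f x)"
  by (auto simp: bwd_diff_def axis_def algebra_simps)

lemma fwd_bwd_diff_coord:
  "fwd_diff i (bwd_diff j (\<lambda>x. x $ l * f x)) x =
     x $ l * fwd_diff i (bwd_diff j f) x
     + of_bool (i = l) * (bwd_diff j f x + fwd_diff i (bwd_diff j f) x)
     + of_bool (j = l) * (fwd_diff i f x - fwd_diff i (bwd_diff j f) x)"
  by (auto simp: fwd_diff_def bwd_diff_def axis_def algebra_simps)

lemma bwd_diff_eq: "bwd_diff j f x = fwd_diff j f x - fwd_diff j (bwd_diff j f) x"
  by (auto simp: fwd_diff_def bwd_diff_def algebra_simps)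

lemma deg_lt_fwd_diff: "deg_lt n f \<Longrightarrow> deg_lt (n - 1) (fwd_diff i f)"
proof (induction rule: deg_lt.induct)
  case (deg_lt_add n f g)
  have "fwd_diff i (\<lambda>x. f x + g x) = (\<lambda>x. fwd_diff i f x + fwd_diff i g x)"
    by (auto simp: fwd_diff_def)
  then show ?case using deg_lt_add deg_lt.deg_lt_add by auto
next
  case (deg_lt_coord n f l)
  show ?case
  proof (cases n)
    case 0
    then have "f = (\<lambda>x. 0)" using deg_lt_0D deg_lt_coord by blast
    then show ?thesis by (auto simp: fwd_diff_def[abs_def] intro: deg_lt_zero)
  next
    case (Suc k)
    have "deg_lt n (fwd_diff i f)" using deg_lt_coord.IH deg_lt_Suc Suc by auto
    then have "deg_lt n (\<lambda>x. x $ l * fwd_diff i f x + of_bool (i = l) * (f x + fwd_diff i f x))"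
      using deg_lt_coord Suc by (intro deg_lt_add deg_lt_cmult) (auto intro: deg_lt.deg_lt_coord)
    then show ?thesis by (simp add: fwd_diff_coord[abs_def])
  qed
qed (auto simp: fwd_diff_def[abs_def] intro: deg_lt.intros)

lemma deg_lt_bwd_diff: "deg_lt n f \<Longrightarrow> deg_lt (n - 1) (bwd_diff i f)"
proof (induction rule: deg_lt.induct)
  case (deg_lt_add n f g)
  have "bwd_diff i (\<lambda>x. f x + g x) = (\<lambda>x. bwd_diff i f x + bwd_diff i g x)"
    by (auto simp: bwd_diff_def)
  then show ?case using deg_lt_add deg_lt.deg_lt_add by auto
next
  case (deg_lt_coord n f l)
  show ?case
  proof (cases n)
    case 0
    then have "f = (\<lambda>x. 0)" using deg_lt_0D deg_lt_coord by blast
    then show ?thesis by (auto simp: bwd_diff_def[abs_def] intro: deg_lt_zero)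
  next
    case (Suc k)
    have "deg_lt n (bwd_diff i f)" using deg_lt_coord.IH deg_lt_Suc Suc by auto
    then have "deg_lt n (\<lambda>x. x $ l * bwd_diff i f x + of_bool (i = l) * (f x + (- 1) * bwd_diff i f x))"
      using deg_lt_coord Suc
      by (intro deg_lt_add deg_lt_cmult) (auto intro: deg_lt.deg_lt_coord)
    then show ?thesis by (simp add: bwd_diff_coord[abs_def])
  qed
qed (auto simp: bwd_diff_def[abs_def] intro: deg_lt.intros)

text \<open>Discrete Euler relation: \<open>\<Sum>\<^sub>j x\<^sub>j \<triangle>\<^sub>j\<close> multiplies the leading part in degree \<open>k\<close> by \<open>k\<close>.\<close>

lemma deg_lt_euler:
  assumes "deg_lt (Suc k) f"
  shows "deg_lt k (\<lambda>x. (\<Sum>j\<in>UNIV. x $ j * fwd_diff j f x) - real k * f x)"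
proof -
  have "n = Suc k \<Longrightarrow> deg_lt k (\<lambda>x. (\<Sum>j\<in>UNIV. x $ j * fwd_diff j f x) + (- real k) * f x)"
    if "deg_lt n f" for n k f
    using that
  proof (induction arbitrary: k rule: deg_lt.induct)
    case (deg_lt_zero n)
    then show ?case by (simp add: fwd_diff_def deg_lt.deg_lt_zero)
  next
    case (deg_lt_add n f g)
    have "(\<lambda>x. (\<Sum>j\<in>UNIV. x $ j * fwd_diff j (\<lambda>x. f x + g x) x) + (- real k) * (f x + g x)) =
      (\<lambda>x. ((\<Sum>j\<in>UNIV. x $ j * fwd_diff j f x) + (- real k) * f x) +
           ((\<Sum>j\<in>UNIV. x $ j * fwd_diff j g x) + (- real k) * g x))"
      by (simp add: fwd_diff_def algebra_simps sum.distrib sum_subtractf fun_eq_iff)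
    then show ?case using deg_lt_add deg_lt.deg_lt_add by simp
  next
    case (deg_lt_const n c)
    then show ?case by (cases k) (auto simp: fwd_diff_def intro: deg_lt.intros)
  next
    case (deg_lt_coord n f l)
    show ?case
    proof (cases n)
      case 0
      then have "f = (\<lambda>x. 0)" using deg_lt_0D deg_lt_coord by blast
      then show ?thesis by (auto simp: fwd_diff_def[abs_def] intro: deg_lt_zero)
    next
      case (Suc m)
      have k: "k = Suc m" using deg_lt_coord Suc by simp
      have "deg_lt k (\<lambda>x. x $ l * ((\<Sum>j\<in>UNIV. x $ j * fwd_diff j f x) + (- real m) * f x)
              + x $ l * fwd_diff l f x)"
        unfolding k using deg_lt_coord.IH[OF Suc] deg_lt_fwd_diff[OF deg_lt_coord.hyps] Suc
        by (intro deg_lt.deg_lt_add[of "Suc m"] deg_lt.deg_lt_coord) simp_all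
      moreover have "x $ l * ((\<Sum>j\<in>UNIV. x $ j * fwd_diff j f x) + (- real m) * f x)
              + x $ l * fwd_diff l f x
          = (\<Sum>j\<in>UNIV. x $ j * fwd_diff j (\<lambda>x. x $ l * f x) x) + (- real k) * (x $ l * f x)" for x
      proof -
        have "(\<Sum>j\<in>UNIV. x $ j * fwd_diff j (\<lambda>x. x $ l * f x) x)
          = (\<Sum>j\<in>UNIV. x $ l * (x $ j * fwd_diff j f x)
               + (if j = l then x $ j * (f x + fwd_diff j f x) else 0))"
          by (rule sum.cong[OF refl], simp only: fwd_diff_coord)
            (auto simp: algebra_simps)
        also have "\<dots> = x $ l * (\<Sum>j\<in>UNIV. x $ j * fwd_diff j f x) + x $ l * (f x + fwd_diff l f x)"
          by (simp add: sum.distrib sum_distrib_left)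
        finally show ?thesis by (simp add: k algebra_simps)
      qed
      ultimately show ?thesis by simp
    qed
  qed
  from this[OF assms] show ?thesis by simp
qed

section \<open>Polynomials as functions\<close>

lemma poly_fun_superset:
  assumes "finite S" "Poly_Mapping.keys p \<subseteq> S"
  shows "poly_fun p x = (\<Sum>\<mu>\<in>S. Poly_Mapping.lookup p \<mu> * mpow x \<mu>)"
  unfolding poly_fun_def using assms
  by (intro sum.mono_neutral_left) (auto simp: in_keys_iff)

lemma poly_fun_zero [simp]: "poly_fun 0 x = 0"
  by (simp add: poly_fun_def)

lemma poly_fun_add: "poly_fun (p + q) x = poly_fun p x + poly_fun q x"
proof -
  let ?S = "Poly_Mapping.keys p \<union> Poly_Mapping.keys q"
  have "Poly_Mapping.keys (p + q) \<subseteq> ?S" by (rule keys_add)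
  then show ?thesis
    by (simp add: poly_fun_superset[of ?S] lookup_add distrib_right sum.distrib)
qed

lemma poly_fun_minus: "poly_fun (p - q) x = poly_fun p x - poly_fun q x"
  using poly_fun_add[of "p - q" q x] by simp

lemma poly_fun_single: "poly_fun (Poly_Mapping.single \<mu> c) x = c * mpow x \<mu>"
  by (simp add: poly_fun_def)

lemma mpow_add: "mpow x (\<mu> + \<nu>) = mpow x \<mu> * mpow x \<nu>"
  by (simp add: mpow_def lookup_add power_add prod.distrib)

lemma mpow_zero [simp]: "mpow x 0 = 1"
  by (simp add: mpow_def)

lemma mpow_single: "mpow x (Poly_Mapping.single i n) = (x $ i) ^ n"
proof -
  have "mpow x (Poly_Mapping.single i n) = (\<Prod>j\<in>UNIV. if j = i then (x $ i) ^ n else 1)"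
    unfolding mpow_def by (rule prod.cong) (auto simp: lookup_single when_def)
  then show ?thesis by simp
qed

lemma mdeg_add: "mdeg (\<mu> + \<nu>) = mdeg \<mu> + mdeg \<nu>"
  by (simp add: mdeg_def lookup_add sum.distrib)

lemma mdeg_zero [simp]: "mdeg 0 = 0"
  by (simp add: mdeg_def)

lemma mdeg_single [simp]: "mdeg (Poly_Mapping.single i n) = n"
proof -
  have "mdeg (Poly_Mapping.single i n) = (\<Sum>j\<in>UNIV. if j = i then n else 0)"
    unfolding mdeg_def by (rule sum.cong) (auto simp: lookup_single when_def)
  then show ?thesis by simp
qed

lemma finite_mdeg_eq: "finite {\<mu> :: ('d::finite) multi_index. mdeg \<mu> = k}"
proof (rule finite_imageD)
  show "finite (Poly_Mapping.lookup ` {\<mu> :: 'd multi_index. mdeg \<mu> = k})"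
  proof (rule finite_subset)
    show "Poly_Mapping.lookup ` {\<mu> :: 'd multi_index. mdeg \<mu> = k} \<subseteq> PiE UNIV (\<lambda>_. {..k})"
    proof -
      have "Poly_Mapping.lookup \<mu> i \<le> mdeg \<mu>" for \<mu> :: "'d multi_index" and i
        unfolding mdeg_def by (intro member_le_sum) auto
      then show ?thesis by auto
    qed
    show "finite (PiE (UNIV :: 'd set) (\<lambda>_. {..k}))" by (rule finite_PiE) auto
  qed
  show "inj_on Poly_Mapping.lookup {\<mu> :: 'd multi_index. mdeg \<mu> = k}"
    by (auto simp: inj_on_def poly_mapping_eqI)
qed

lemma poly_mapping_add_single_induct [case_names zero add_single]:
  fixes p :: "'a \<Rightarrow>\<^sub>0 'b :: comm_monoid_add"
  assumes "P 0" and step: "\<And>k v p. P p \<Longrightarrow> P (Poly_Mapping.single k v + p)"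
  shows "P p"
proof (induction p rule: update_induct)
  case const
  then show ?case using assms by simp
next
  case (update p k v)
  have "Poly_Mapping.update k v p = Poly_Mapping.single k v + p"
    using update(1)
    by (intro poly_mapping_eqI)
      (auto simp: lookup_add lookup_single when_def lookup_update in_keys_iff)
  then show ?case using step update by metis
qed

lemma poly_fun_single_mult:
  "poly_fun (Poly_Mapping.single \<nu> c * p) x = c * mpow x \<nu> * poly_fun p x"
proof (induction p rule: poly_mapping_add_single_induct)
  case zero
  show ?case by simp
next
  case (add_single k v p)
  then show ?case
    by (simp add: distrib_left poly_fun_add mult_single poly_fun_single mpow_add)
qed

lemma poly_fun_sum: "poly_fun (\<Sum>i\<in>I. p i) x = (\<Sum>i\<in>I. poly_fun (p i) x)"
  by (induction I rule: infinite_finite_induct) (auto simp: poly_fun_add)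

lemma lookup_const_mult:
  "Poly_Mapping.lookup (Poly_Mapping.single 0 c * p) \<mu> = c * Poly_Mapping.lookup p \<mu>"
proof (induction p rule: poly_mapping_add_single_induct)
  case zero
  show ?case by simp
next
  case (add_single k v p)
  then show ?case
    by (simp add: distrib_left lookup_add mult_single lookup_single when_def)
qed

lemma poly_fun_lincomb:
  "poly_fun (\<Sum>i\<in>I. Poly_Mapping.single 0 (c i) * p i) x = (\<Sum>i\<in>I. c i * poly_fun (p i) x)"
  by (simp add: poly_fun_sum poly_fun_single_mult)

lemma deg_lt_monomial: "deg_lt (Suc (mdeg \<mu>)) (\<lambda>x. c * mpow x \<mu>)"
proof -
  have pw: "deg_lt (Suc (e + k)) (\<lambda>x. (x $ i) ^ e * f x)" if "deg_lt (Suc k) f"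
    for e k i and f :: "real ^ 'a \<Rightarrow> real"
    using that
    by (induction e) (auto simp: mult.assoc intro: deg_lt_coord)
  have "deg_lt (Suc (\<Sum>i\<in>S. Poly_Mapping.lookup \<mu> i)) (\<lambda>x. \<Prod>i\<in>S. (x $ i) ^ Poly_Mapping.lookup \<mu> i)"
    for S :: "'a set"
    by (induction S rule: infinite_finite_induct) (auto intro: deg_lt_const pw)
  then show ?thesis unfolding mdeg_def mpow_def by (intro deg_lt_cmult) auto
qed

lemma deg_lt_poly_fun:
  assumes "\<And>\<mu>. \<mu> \<in> Poly_Mapping.keys p \<Longrightarrow> mdeg \<mu> < n"
  shows "deg_lt n (poly_fun p)"
  unfolding poly_fun_def[abs_def]
  by (rule deg_lt_sum, rule deg_lt_mono[OF deg_lt_monomial]) (use assms in \<open>auto simp: Suc_le_eq\<close>)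

lemma deg_lt_imp_poly_fun:
  "deg_lt n f \<Longrightarrow> \<exists>p. (\<forall>\<mu>\<in>Poly_Mapping.keys p. mdeg \<mu> < n) \<and> f = poly_fun p"
proof (induction rule: deg_lt.induct)
  case (deg_lt_zero n)
  show ?case by (rule exI[of _ 0]) auto
next
  case (deg_lt_add n f g)
  then obtain p q where "\<forall>\<mu>\<in>Poly_Mapping.keys p. mdeg \<mu> < n" "f = poly_fun p"
     "\<forall>\<mu>\<in>Poly_Mapping.keys q. mdeg \<mu> < n" "g = poly_fun q" by blast
  then show ?case using keys_add[of p q]
    by (intro exI[of _ "p + q"]) (auto simp: poly_fun_add)
next
  case (deg_lt_const n c)
  show ?case by (rule exI[of _ "Poly_Mapping.single 0 c"]) (auto simp: poly_fun_single)
next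
  case (deg_lt_coord n f l)
  then obtain p where p: "\<forall>\<mu>\<in>Poly_Mapping.keys p. mdeg \<mu> < n" "f = poly_fun p" by blast
  let ?q = "Poly_Mapping.single (Poly_Mapping.single l 1) 1 * p"
  have "\<forall>\<mu>\<in>Poly_Mapping.keys ?q. mdeg \<mu> < Suc n"
  proof
    fix \<mu> assume "\<mu> \<in> Poly_Mapping.keys ?q"
    then obtain a b where "\<mu> = a + b" "a \<in> Poly_Mapping.keys (Poly_Mapping.single (Poly_Mapping.single l (1::nat)) (1::real))"
      "b \<in> Poly_Mapping.keys p" using keys_mult by blast
    then show "mdeg \<mu> < Suc n" using p by (auto simp: mdeg_add)
  qed
  moreover have "(\<lambda>x. x $ l * f x) = poly_fun ?q"
    by (auto simp: p poly_fun_single_mult mpow_single)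
  ultimately show ?case by blast
qed

section \<open>Functions agreeing with a polynomial on a set\<close>

text \<open>\<open>deg_lt_on V n f\<close> says that \<open>f\<close> coincides on \<open>V\<close> with a polynomial of degree less than \<open>n\<close>,
  that is, its class lies in the image of \<open>\<Pi>\<^sub>n\<^sub>-\<^sub>1\<close>. Differences of \<open>f\<close> need not inherit this, as they
  involve values outside \<open>V\<close>.\<close>

definition deg_lt_on :: "(real ^ ('d::finite)) set \<Rightarrow> nat \<Rightarrow> (real ^ 'd \<Rightarrow> real) \<Rightarrow> bool"
  where "deg_lt_on V n f \<longleftrightarrow> (\<exists>g. deg_lt n g \<and> (\<forall>x\<in>V. f x = g x))"

lemma deg_lt_on_cong: "deg_lt_on V n f \<Longrightarrow> (\<And>x. x \<in> V \<Longrightarrow> f x = g x) \<Longrightarrow> deg_lt_on V n g"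
  unfolding deg_lt_on_def by auto

lemma deg_lt_imp_on: "deg_lt n f \<Longrightarrow> deg_lt_on V n f"
  unfolding deg_lt_on_def by auto

lemma deg_lt_on_mono: "deg_lt_on V n f \<Longrightarrow> n \<le> m \<Longrightarrow> deg_lt_on V m f"
  unfolding deg_lt_on_def using deg_lt_mono by blast

lemma deg_lt_on_0: "deg_lt_on V 0 f \<longleftrightarrow> (\<forall>x\<in>V. f x = 0)"
  unfolding deg_lt_on_def using deg_lt_0D deg_lt_zero by fastforce

lemma deg_lt_on_zero: "deg_lt_on V n (\<lambda>x. 0)"
  by (intro deg_lt_imp_on deg_lt_zero)

lemma deg_lt_on_add:
  "deg_lt_on V n f \<Longrightarrow> deg_lt_on V n g \<Longrightarrow> deg_lt_on V n (\<lambda>x. f x + g x)"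
  unfolding deg_lt_on_def using deg_lt_add by fastforce

lemma deg_lt_on_cmult: "deg_lt_on V n f \<Longrightarrow> deg_lt_on V n (\<lambda>x. c * f x)"
  unfolding deg_lt_on_def using deg_lt_cmult by fastforce

lemma deg_lt_on_diff:
  "deg_lt_on V n f \<Longrightarrow> deg_lt_on V n g \<Longrightarrow> deg_lt_on V n (\<lambda>x. f x - g x)"
  using deg_lt_on_add[of V n f "\<lambda>x. (- 1) * g x"] deg_lt_on_cmult[of V n g "- 1"] by simp

lemma deg_lt_on_sum:
  "(\<And>i. i \<in> I \<Longrightarrow> deg_lt_on V n (f i)) \<Longrightarrow> deg_lt_on V n (\<lambda>x. \<Sum>i\<in>I. f i x)"
  by (induction I rule: infinite_finite_induct) (auto intro: deg_lt_on_add deg_lt_on_zero)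

lemma deg_lt_on_mult:
  assumes "deg_lt_on V n f" "deg_lt_on V m g" "n = 0 \<or> m = 0 \<or> n + m \<le> Suc r"
  shows "deg_lt_on V r (\<lambda>x. f x * g x)"
proof -
  obtain f' g' where "deg_lt n f'" "deg_lt m g'" "\<forall>x\<in>V. f x = f' x" "\<forall>x\<in>V. g x = g' x"
    using assms unfolding deg_lt_on_def by blast
  then show ?thesis using deg_lt_mult[OF _ _ assms(3)]
    unfolding deg_lt_on_def by (intro exI[of _ "\<lambda>x. f' x * g' x"]) auto
qed

lemma deg_lt_on_coord: "deg_lt_on V n f \<Longrightarrow> deg_lt_on V (Suc n) (\<lambda>x. x $ l * f x)"
  unfolding deg_lt_on_def using deg_lt_coord by fastforce

lemma Pi_le_deg_lt_on:
  "(\<exists>p\<in>Pi_le n. \<forall>x\<in>V. f x = poly_fun p x) \<longleftrightarrow> deg_lt_on V (Suc n) f"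
proof
  assume "\<exists>p\<in>Pi_le n. \<forall>x\<in>V. f x = poly_fun p x"
  then obtain p where p: "p \<in> Pi_le n" "\<forall>x\<in>V. f x = poly_fun p x" by blast
  then have "deg_lt (Suc n) (poly_fun p)"
    by (intro deg_lt_poly_fun) (auto simp: Pi_le_def less_Suc_eq_le)
  then show "deg_lt_on V (Suc n) f" using p unfolding deg_lt_on_def by blast
next
  assume "deg_lt_on V (Suc n) f"
  then obtain g where "deg_lt (Suc n) g" "\<forall>x\<in>V. f x = g x" unfolding deg_lt_on_def by blast
  then show "\<exists>p\<in>Pi_le n. \<forall>x\<in>V. f x = poly_fun p x"
    using deg_lt_imp_poly_fun[of "Suc n" g] by (auto simp: Pi_le_def less_Suc_eq_le)
qed

lemma poly_on_iff: "poly_on V n f \<longleftrightarrow> deg_lt_on V (Suc n) f"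
  by (simp add: poly_on_def Pi_le_deg_lt_on)

lemma cong_on_iff: "cong_on V n f g \<longleftrightarrow> deg_lt_on V (Suc n) (\<lambda>x. f x - g x)"
  by (simp add: cong_on_def poly_on_iff)

lemma vanishing_diff_iff:
  "p - q \<in> vanishing_ideal V \<longleftrightarrow> (\<forall>x\<in>V. poly_fun p x = poly_fun q x)"
  by (simp add: vanishing_ideal_def poly_fun_minus)

lemma deg_lt_on_poly_fun: "\<exists>n. deg_lt_on V (Suc n) (poly_fun p)"
proof -
  have "mdeg \<mu> < Suc (Max (mdeg ` Poly_Mapping.keys p))" if "\<mu> \<in> Poly_Mapping.keys p" for \<mu>
    using that by (simp add: less_Suc_eq_le)
  then show ?thesis using deg_lt_imp_on[OF deg_lt_poly_fun] by blast
qed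

lemma class_degree_less_iff:
  "class_degree V p < k \<longleftrightarrow> 0 < k \<and> deg_lt_on V k (poly_fun p)"
proof -
  have eq: "class_degree V p = (LEAST n. deg_lt_on V (Suc n) (poly_fun p))"
    by (simp add: class_degree_def vanishing_diff_iff Pi_le_deg_lt_on)
  have 1: "deg_lt_on V (Suc (class_degree V p)) (poly_fun p)"
    unfolding eq using deg_lt_on_poly_fun by (rule LeastI_ex)
  have 2: "class_degree V p \<le> n" if "deg_lt_on V (Suc n) (poly_fun p)" for n
    unfolding eq using that by (rule Least_le)
  show ?thesis
  proof (cases k)
    case (Suc n)
    then show ?thesis using 1 2[of n] deg_lt_on_mono[OF 1, of k] by auto
  qed auto
qed

section \<open>Normal forms modulo the vanishing ideal\<close>

lemma lattice_normal_form:
  assumes "lattice_set V \<Lambda>" "deg_lt_on V n f"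
  obtains c where "Poly_Mapping.keys c \<subseteq> {\<mu> \<in> \<Lambda>. mdeg \<mu> < n}" "\<And>x. x \<in> V \<Longrightarrow> f x = poly_fun c x"
proof (cases n)
  case 0
  then show ?thesis using assms that[of 0] by (auto simp: deg_lt_on_0)
next
  case (Suc m)
  obtain p where p: "p \<in> Pi_le m" "\<forall>x\<in>V. f x = poly_fun p x"
    using assms Suc Pi_le_deg_lt_on by metis
  then obtain c where "Poly_Mapping.keys c \<subseteq> {\<mu> \<in> \<Lambda>. mdeg \<mu> \<le> m}" "p - c \<in> vanishing_ideal V"
    using assms(1) unfolding lattice_set_def by metis
  then show ?thesis using that[of c] p Suc by (simp add: vanishing_diff_iff less_Suc_eq_le)
qed

lemma lattice_unique:
  assumes "lattice_set V \<Lambda>" "Poly_Mapping.keys c \<subseteq> \<Lambda>" "Poly_Mapping.keys c' \<subseteq> \<Lambda>"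
    "\<And>x. x \<in> V \<Longrightarrow> poly_fun c x = poly_fun c' x"
  shows "c = c'"
proof -
  have "\<exists>!e. Poly_Mapping.keys e \<subseteq> \<Lambda> \<and> c - e \<in> vanishing_ideal V"
    using assms(1) unfolding lattice_set_def by blast
  moreover have "c - c \<in> vanishing_ideal V" "c - c' \<in> vanishing_ideal V"
    using assms(4) unfolding vanishing_diff_iff by auto
  ultimately show ?thesis using assms(2,3) by blast
qed

text \<open>The degree filtration is visible in normal forms: a combination of lattice monomials whose
  class has a representative of degree less than \<open>n\<close> involves only monomials of degree less
  than \<open>n\<close>.\<close>

lemma lattice_keys_less:
  assumes "lattice_set V \<Lambda>" "Poly_Mapping.keys c \<subseteq> \<Lambda>" "deg_lt_on V n (poly_fun c)"
    "\<mu> \<in> Poly_Mapping.keys c"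
  shows "mdeg \<mu> < n"
proof -
  obtain e where "Poly_Mapping.keys e \<subseteq> {\<mu> \<in> \<Lambda>. mdeg \<mu> < n}"
    "\<And>x. x \<in> V \<Longrightarrow> poly_fun c x = poly_fun e x"
    using lattice_normal_form[OF assms(1,3)] by blast
  moreover from this have "c = e" using lattice_unique[OF assms(1,2)] by blast
  ultimately show ?thesis using assms(4) by auto
qed

lemma lattice_layer_empty:
  assumes "lattice_set V \<Lambda>" "lattice_count \<Lambda> n = 0" "deg_lt_on V (Suc n) f"
  shows "deg_lt_on V n f"
proof -
  have "{\<mu> \<in> \<Lambda>. mdeg \<mu> = n} = {}"
    using assms(2) finite_subset[OF _ finite_mdeg_eq[of n], of "{\<mu> \<in> \<Lambda>. mdeg \<mu> = n}"]
    unfolding lattice_count_def by (auto simp: card_eq_0_iff)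
  moreover obtain c where c: "Poly_Mapping.keys c \<subseteq> {\<mu> \<in> \<Lambda>. mdeg \<mu> < Suc n}"
    "\<And>x. x \<in> V \<Longrightarrow> f x = poly_fun c x"
    using lattice_normal_form[OF assms(1,3)] by blast
  ultimately have "deg_lt n (poly_fun c)"
    by (intro deg_lt_poly_fun) (fastforce simp: less_Suc_eq)
  then show ?thesis using c deg_lt_on_def by blast
qed

section \<open>Square linear systems\<close>

text \<open>More vectors than coordinates are linearly dependent, by Gaussian elimination of one coordinate
  at a time.\<close>

lemma nontrivial_relation:
  fixes w :: "'i \<Rightarrow> 's \<Rightarrow> real"
  assumes "finite S" "finite I" "card S < card I"
  shows "\<exists>c. (\<exists>i\<in>I. c i \<noteq> 0) \<and> (\<forall>s\<in>S. (\<Sum>i\<in>I. c i * w i s) = 0)"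
  using assms
proof (induction S arbitrary: I w rule: finite_induct)
  case empty
  then show ?case by (intro exI[of _ "\<lambda>_. 1"]) (auto simp: card_gt_0_iff)
next
  case (insert s S)
  show ?case
  proof (cases "\<forall>i\<in>I. w i s = 0")
    case True
    have "card S < card I" using insert by simp
    then obtain c where "\<exists>i\<in>I. c i \<noteq> 0" "\<forall>s\<in>S. (\<Sum>i\<in>I. c i * w i s) = 0"
      using insert.IH[OF insert.prems(1), of w] by blast
    then show ?thesis using True by (intro exI[of _ c]) auto
  next
    case False
    then obtain j where j: "j \<in> I" "w j s \<noteq> 0" by blast
    define I' where "I' = I - {j}"
    have I': "finite I'" "j \<notin> I'" "I = insert j I'" using j insert.prems by (auto simp: I'_def)
    then have "card S < card I'" using insert by simp
    from insert.IH[OF I'(1) this, of "\<lambda>i t. w i t - w i s / w j s * w j t"]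
    obtain c where c: "\<exists>i\<in>I'. c i \<noteq> 0"
      "\<And>t. t \<in> S \<Longrightarrow> (\<Sum>i\<in>I'. c i * (w i t - w i s / w j s * w j t)) = 0" by blast
    \<comment> \<open>The coefficient of the pivot vector \<open>j\<close> is chosen to cancel coordinate \<open>s\<close>.\<close>
    define c' where "c' = c(j := - (\<Sum>i\<in>I'. c i * w i s) / w j s)"
    have c'_eq: "(\<Sum>i\<in>I. c' i * w i t) = (\<Sum>i\<in>I'. c i * (w i t - w i s / w j s * w j t))" for t
    proof -
      have "(\<Sum>i\<in>I'. c' i * w i t) = (\<Sum>i\<in>I'. c i * w i t)"
        using I' by (intro sum.cong) (auto simp: c'_def)
      moreover have "(\<Sum>i\<in>I'. c i * (w i t - w i s / w j s * w j t)) =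
        (\<Sum>i\<in>I'. c i * w i t) - (\<Sum>i\<in>I'. c i * w i s) / w j s * w j t"
        by (simp add: algebra_simps sum_subtractf sum_divide_distrib sum_distrib_left)
      ultimately show ?thesis using I' by (simp add: c'_def)
    qed
    have "(\<Sum>i\<in>I. c' i * w i s) = 0" unfolding c'_eq using j by simp
    moreover have "\<exists>i\<in>I. c' i \<noteq> 0" using c(1) I' by (auto simp: c'_def)
    ultimately show ?thesis using c(2) c'_eq by (intro exI[of _ c']) auto
  qed
qed

lemma square_system_solvable:
  fixes w :: "nat \<Rightarrow> 's \<Rightarrow> real"
  assumes "finite S"
    and inj: "\<And>c. (\<And>s. s \<in> S \<Longrightarrow> (\<Sum>i<card S. c i * w i s) = 0) \<Longrightarrow> \<forall>i<card S. c i = 0"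
  obtains d where "\<And>s. s \<in> S \<Longrightarrow> (\<Sum>i<card S. d i * w i s) = t s"
proof -
  \<comment> \<open>A nontrivial relation among the vectors \<open>w i\<close> and the target \<open>t\<close> must involve \<open>t\<close>.\<close>
  define w' where "w' = w(card S := t)"
  obtain c where c: "\<exists>i\<in>{..card S}. c i \<noteq> 0" "\<And>s. s \<in> S \<Longrightarrow> (\<Sum>i\<le>card S. c i * w' i s) = 0"
    using nontrivial_relation[OF assms(1), of "{..card S}" w'] by auto
  have eq: "(\<Sum>i\<le>card S. c i * w' i s) = (\<Sum>i<card S. c i * w i s) + c (card S) * t s" for s
    unfolding lessThan_Suc_atMost[symmetric] by (simp add: w'_def)
  have "c (card S) \<noteq> 0"
  proof
    assume 0: "c (card S) = 0"
    then have "\<forall>i<card S. c i = 0" using inj[of c] c(2) eq by simp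
    then show False using c(1) 0 by (auto simp: le_less)
  qed
  then have "(\<Sum>i<card S. (- c i / c (card S)) * w i s) = t s" if "s \<in> S" for s
    using c(2)[OF that] unfolding eq
    by (simp add: sum_negf flip: sum_divide_distrib) (simp add: field_simps)
  then show ?thesis by (rule that)
qed

section \<open>The difference operator on a polynomial layer\<close>

lemma diff_op_add:
  "diff_op A B (\<lambda>x. f x + g x) x = diff_op A B f x + diff_op A B g x"
  by (simp add: diff_op_def fwd_diff_def bwd_diff_def algebra_simps sum.distrib sum_subtractf)

lemma fwd_diff_cmult: "fwd_diff i (\<lambda>x. c * f x) = (\<lambda>x. c * fwd_diff i f x)"
  by (auto simp: fwd_diff_def algebra_simps)

lemma bwd_diff_cmult: "bwd_diff i (\<lambda>x. c * f x) = (\<lambda>x. c * bwd_diff i f x)"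
  by (auto simp: bwd_diff_def algebra_simps)

lemma diff_op_cmult: "diff_op A B (\<lambda>x. c * f x) x = c * diff_op A B f x"
  by (simp add: diff_op_def fwd_diff_cmult bwd_diff_cmult sum_distrib_left algebra_simps)

lemma diff_op_const [simp]: "diff_op A B (\<lambda>x. c) x = 0"
  by (simp add: diff_op_def fwd_diff_def bwd_diff_def)

lemma diff_op_diff:
  "diff_op A B (\<lambda>x. f x - g x) x = diff_op A B f x - diff_op A B g x"
  using diff_op_add[of A B f "\<lambda>x. (- 1) * g x"] diff_op_cmult[of A B "- 1" g] by simp

lemma diff_op_sum:
  "diff_op A B (\<lambda>x. \<Sum>i\<in>I. c i * f i x) x = (\<Sum>i\<in>I. c i * diff_op A B (f i) x)"
  by (induction I rule: infinite_finite_induct) (simp_all add: diff_op_add diff_op_cmult)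

text \<open>The grouping separates the terms of top degree (first line) from those that drop the degree
  once more. It uses \<open>\<nabla>\<^sub>j = \<triangle>\<^sub>j - \<triangle>\<^sub>j \<nabla>\<^sub>j\<close> (\<open>bwd_diff_eq\<close>), so that only the symmetric part
  of \<open>A\<close> occurs in the leading terms.\<close>

lemma diff_op_coord:
  "diff_op A B (\<lambda>x. x $ l * f x) x =
     x $ l * diff_op A B f x + (\<Sum>j\<in>UNIV. (A l j x + A j l x) * fwd_diff j f x) + B l x * f x
     + ((\<Sum>j\<in>UNIV. A l j x * (fwd_diff l (bwd_diff j f) x - fwd_diff j (bwd_diff j f) x))
        - (\<Sum>i\<in>UNIV. A i l x * fwd_diff i (bwd_diff l f) x) + B l x * fwd_diff l f x)"
proof -
  have 1: "(\<Sum>j\<in>UNIV. A i j x * fwd_diff i (bwd_diff j (\<lambda>x. x $ l * f x)) x)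
     = x $ l * (\<Sum>j\<in>UNIV. A i j x * fwd_diff i (bwd_diff j f) x)
       + (if i = l then (\<Sum>j\<in>UNIV. A l j x * (bwd_diff j f x + fwd_diff l (bwd_diff j f) x)) else 0)
       + A i l x * (fwd_diff i f x - fwd_diff i (bwd_diff l f) x)" for i
  proof -
    have "(\<Sum>j\<in>UNIV. A i j x * fwd_diff i (bwd_diff j (\<lambda>x. x $ l * f x)) x)
     = (\<Sum>j\<in>UNIV. x $ l * (A i j x * fwd_diff i (bwd_diff j f) x)
       + (if i = l then A l j x * (bwd_diff j f x + fwd_diff l (bwd_diff j f) x) else 0)
       + (if j = l then A i j x * (fwd_diff i f x - fwd_diff i (bwd_diff j f) x) else 0))"
      by (rule sum.cong[OF refl], simp only: fwd_bwd_diff_coord) (auto simp: algebra_simps)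
    then show ?thesis by (simp add: sum.distrib sum_distrib_left)
  qed
  have 2: "(\<Sum>i\<in>UNIV. B i x * fwd_diff i (\<lambda>x. x $ l * f x) x)
     = x $ l * (\<Sum>i\<in>UNIV. B i x * fwd_diff i f x) + B l x * (f x + fwd_diff l f x)"
  proof -
    have "(\<Sum>i\<in>UNIV. B i x * fwd_diff i (\<lambda>x. x $ l * f x) x)
      = (\<Sum>i\<in>UNIV. x $ l * (B i x * fwd_diff i f x)
           + (if i = l then B i x * (f x + fwd_diff i f x) else 0))"
      by (rule sum.cong[OF refl], simp only: fwd_diff_coord) (auto simp: algebra_simps)
    then show ?thesis by (simp add: sum.distrib sum_distrib_left)
  qed
  have "diff_op A B (\<lambda>x. x $ l * f x) x =
     x $ l * diff_op A B f x
     + (\<Sum>j\<in>UNIV. A l j x * (bwd_diff j f x + fwd_diff l (bwd_diff j f) x))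
     + (\<Sum>i\<in>UNIV. A i l x * (fwd_diff i f x - fwd_diff i (bwd_diff l f) x))
     + B l x * (f x + fwd_diff l f x)"
    unfolding diff_op_def 1 2 sum.distrib sum_distrib_left[symmetric] distrib_left[of "x $ l"]
    by simp
  then show ?thesis
    unfolding bwd_diff_eq[of _ f x] by (simp add: algebra_simps sum.distrib sum_subtractf)
qed

text \<open>\<open>acts_on_layer V D k e\<close> says that \<open>D\<close> acts on polynomials of degree at most \<open>k\<close>, modulo functions
  that agree on \<open>V\<close> with a polynomial of degree less than \<open>k\<close>, as multiplication by \<open>e\<close>. It refers to polynomial functions on the whole
  space; \<open>acts_on_layer_on\<close> transfers it to functions known on \<open>V\<close> only.\<close>

definition acts_on_layer ::
    "(real ^ ('d::finite)) set \<Rightarrow> ((real ^ 'd \<Rightarrow> real) \<Rightarrow> real ^ 'd \<Rightarrow> real) \<Rightarrow> nat \<Rightarrow> real \<Rightarrow> bool"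
  where "acts_on_layer V D k e \<longleftrightarrow>
    (\<forall>f. deg_lt (Suc k) f \<longrightarrow> deg_lt_on V k (\<lambda>x. D f x - e * f x))"

lemma coeff_conditions_imp_acts_on_layer:
  assumes "coeff_conditions V A B a b"
  shows "acts_on_layer V (diff_op A B) k (eigenvalue a b k)"
proof -
  have B: "deg_lt_on V 2 (B i)" "deg_lt_on V 1 (\<lambda>x. B i x - b * x $ i)" for i
    using assms by (auto simp: coeff_conditions_def poly_on_iff cong_on_iff numeral_2_eq_2)
  have A: "deg_lt_on V 3 (A i j)" for i j
    using assms by (auto simp: coeff_conditions_def poly_on_iff numeral_3_eq_3 numeral_2_eq_2)
  have S: "deg_lt_on V 2 (\<lambda>x. A i j x + A j i x - 2 * a * (x $ i) * (x $ j))" for i j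
  proof (cases "i = j")
    case True
    have "deg_lt_on V 2 (\<lambda>x. A i i x - a * (x $ i)\<^sup>2)"
      using assms by (auto simp: coeff_conditions_def cong_on_iff numeral_2_eq_2)
    from deg_lt_on_cmult[OF this, of 2] show ?thesis
      by (rule deg_lt_on_cong) (auto simp: True power2_eq_square algebra_simps)
  next
    case False
    then show ?thesis
      using assms by (auto simp: coeff_conditions_def cong_on_iff numeral_2_eq_2)
  qed
  have "n = Suc k \<Longrightarrow> deg_lt_on V k (\<lambda>x. diff_op A B f x - eigenvalue a b k * f x)"
    if "deg_lt n f" for n k f
    using that
  proof (induction arbitrary: k rule: deg_lt.induct)
    case (deg_lt_zero n)
    then show ?case by (simp add: deg_lt_on_zero)
  next
    case (deg_lt_add n f g)
    show ?case
      by (rule deg_lt_on_cong[OF deg_lt_on_add[OF deg_lt_add.IH(1) deg_lt_add.IH(2)]])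
        (use deg_lt_add.prems in \<open>auto simp: diff_op_add algebra_simps\<close>)
  next
    case (deg_lt_const n c)
    then show ?case
      by (cases k) (auto simp: eigenvalue_def deg_lt_on_0 intro: deg_lt_imp_on deg_lt.intros)
  next
    case (deg_lt_coord n f l)
    show ?case
    proof (cases n)
      case 0
      then have "f = (\<lambda>x. 0)" using deg_lt_0D deg_lt_coord.hyps by blast
      then show ?thesis by (simp add: deg_lt_on_zero)
    next
      case (Suc m)
      have k: "k = Suc m" using deg_lt_coord Suc by simp
      have f: "deg_lt_on V (Suc m) f" "deg_lt_on V m (fwd_diff j f)"
        "deg_lt_on V (m - 1) (fwd_diff i (bwd_diff j f))" for i j
        using deg_lt_coord.hyps Suc deg_lt_fwd_diff[OF deg_lt_coord.hyps, of j]
          deg_lt_fwd_diff[OF deg_lt_bwd_diff[OF deg_lt_coord.hyps, of j], of i]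
        by (auto intro: deg_lt_imp_on)
      \<comment> \<open>For \<open>m = 0\<close> the truncated bound \<open>m - 1 = 0\<close> says that second differences vanish.\<close>
      have r: "deg_lt_on V k (\<lambda>x.
          (\<Sum>j\<in>UNIV. A l j x * (fwd_diff l (bwd_diff j f) x - fwd_diff j (bwd_diff j f) x))
        - (\<Sum>i\<in>UNIV. A i l x * fwd_diff i (bwd_diff l f) x) + B l x * fwd_diff l f x)"
        by (intro deg_lt_on_add deg_lt_on_diff deg_lt_on_sum
            deg_lt_on_mult[OF A deg_lt_on_diff[OF f(3) f(3)]]
            deg_lt_on_mult[OF A f(3)] deg_lt_on_mult[OF B(1) f(2)]) (auto simp: k)
      have s: "deg_lt_on V k (\<lambda>x. \<Sum>j\<in>UNIV.
          (A l j x + A j l x - 2 * a * (x $ l) * (x $ j)) * fwd_diff j f x)"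
        by (intro deg_lt_on_sum deg_lt_on_mult[OF S f(2)]) (auto simp: k)
      have t: "deg_lt_on V k (\<lambda>x. (B l x - b * x $ l) * f x)"
        by (rule deg_lt_on_mult[OF B(2) f(1)]) (auto simp: k)
      have u: "deg_lt_on V k (\<lambda>x. x $ l * (diff_op A B f x - eigenvalue a b m * f x))"
        unfolding k by (rule deg_lt_on_coord[OF deg_lt_coord.IH[OF Suc]])
      have v: "deg_lt_on V k (\<lambda>x. x $ l *
          (2 * a * ((\<Sum>j\<in>UNIV. x $ j * fwd_diff j f x) - real m * f x)))"
        unfolding k using deg_lt_coord.hyps Suc
        by (intro deg_lt_on_coord deg_lt_on_cmult deg_lt_imp_on deg_lt_euler) simp
      show ?thesis
      proof (rule deg_lt_on_cong[OF deg_lt_on_add[OF deg_lt_on_add[OF u s]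
              deg_lt_on_add[OF v deg_lt_on_add[OF t r]]]])
        fix x
        have "(\<Sum>j\<in>UNIV. (A l j x + A j l x - 2 * a * (x $ l) * (x $ j)) * fwd_diff j f x)
          = (\<Sum>j\<in>UNIV. (A l j x + A j l x) * fwd_diff j f x)
            - 2 * a * x $ l * (\<Sum>j\<in>UNIV. x $ j * fwd_diff j f x)"
          unfolding sum_distrib_left sum_subtractf[symmetric]
          by (rule sum.cong) (auto simp: algebra_simps)
        then show "x $ l * (diff_op A B f x - eigenvalue a b m * f x) +
           (\<Sum>j\<in>UNIV. (A l j x + A j l x - 2 * a * (x $ l) * (x $ j)) * fwd_diff j f x) +
           (x $ l * (2 * a * ((\<Sum>j\<in>UNIV. x $ j * fwd_diff j f x) - real m * f x)) +
             ((B l x - b * x $ l) * f x +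
             ((\<Sum>j\<in>UNIV. A l j x * (fwd_diff l (bwd_diff j f) x - fwd_diff j (bwd_diff j f) x))
             - (\<Sum>i\<in>UNIV. A i l x * fwd_diff i (bwd_diff l f) x) + B l x * fwd_diff l f x)))
          = diff_op A B (\<lambda>x. x $ l * f x) x - eigenvalue a b k * (x $ l * f x)"
          unfolding diff_op_coord by (simp add: k eigenvalue_def algebra_simps)
      qed
    qed
  qed
  then show ?thesis by (simp add: acts_on_layer_def)
qed

text \<open>Invariance of the vanishing ideal makes \<open>D\<close> well defined on \<open>\<real>[V]\<close>.\<close>

lemma ideal_invariant_cong:
  assumes "ideal_invariant V (diff_op A B)" "deg_lt n f" "deg_lt m g"
    "\<And>x. x \<in> V \<Longrightarrow> f x = g x" "x \<in> V"
  shows "diff_op A B f x = diff_op A B g x"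
proof -
  obtain p q where p: "f = poly_fun p" and q: "g = poly_fun q"
    using deg_lt_imp_poly_fun assms(2,3) by metis
  have "p - q \<in> vanishing_ideal V" using assms(4) p q by (simp add: vanishing_diff_iff)
  then obtain r where "r \<in> vanishing_ideal V" "\<forall>x\<in>V. diff_op A B (poly_fun (p - q)) x = poly_fun r x"
    using assms(1) unfolding ideal_invariant_def by blast
  then have "diff_op A B (\<lambda>x. poly_fun p x - poly_fun q x) x = 0"
    using assms(5) by (simp add: vanishing_ideal_def poly_fun_minus[abs_def])
  then show ?thesis by (simp add: p q diff_op_diff)
qed

lemma deg_lt_poly_fun_ex: "\<exists>n. deg_lt n (poly_fun p)"
  using deg_lt_poly_fun[of p "Suc (Max (mdeg ` Poly_Mapping.keys p))"]
  by (auto simp: less_Suc_eq_le)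

lemma acts_on_layer_on:
  assumes "ideal_invariant V (diff_op A B)" "acts_on_layer V (diff_op A B) k e"
    "deg_lt_on V (Suc k) (poly_fun u)"
  shows "deg_lt_on V k (\<lambda>x. diff_op A B (poly_fun u) x - e * poly_fun u x)"
proof -
  obtain g where g: "deg_lt (Suc k) g" "\<And>x. x \<in> V \<Longrightarrow> poly_fun u x = g x"
    using assms(3) unfolding deg_lt_on_def by blast
  obtain n where "deg_lt n (poly_fun u)" using deg_lt_poly_fun_ex by blast
  then have Dg: "diff_op A B (poly_fun u) x = diff_op A B g x" if "x \<in> V" for x
    using ideal_invariant_cong[OF assms(1)] g that by blast
  have "deg_lt_on V k (\<lambda>x. diff_op A B g x - e * g x)"
    using assms(2) g(1) unfolding acts_on_layer_def by blast
  then show ?thesis by (rule deg_lt_on_cong) (simp add: Dg g(2))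
qed

section \<open>Admissibility\<close>

lemma lin_indep_mod_iff:
  "lin_indep_mod V r u \<longleftrightarrow>
    (\<forall>c. (\<forall>x\<in>V. (\<Sum>i<r. c i * poly_fun (u i) x) = 0) \<longrightarrow> (\<forall>i<r. c i = 0))"
  by (simp add: lin_indep_mod_def vanishing_ideal_def poly_fun_lincomb)

lemma lin_indep_mod_nonzero:
  assumes "lin_indep_mod V r u" "i < r"
  shows "\<exists>x\<in>V. poly_fun (u i) x \<noteq> 0"
proof (rule ccontr)
  assume "\<not> ?thesis"
  then have "\<forall>x\<in>V. (\<Sum>j<r. of_bool (j = i) * poly_fun (u j) x) = 0"
    by (auto intro!: sum.neutral)
  then have "\<forall>j<r. (of_bool (j = i) :: real) = 0"
    by (rule assms(1)[unfolded lin_indep_mod_iff, THEN spec, THEN mp])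
  then show False using assms(2) by auto
qed

text \<open>Admissibility in degree \<open>k\<close> without reference to \<^const>\<open>class_degree\<close>. An upper bound on the degree
  of the independent solutions suffices, since the second condition excludes lower degrees.\<close>

lemma admissible_at_iff:
  "admissible_at V \<Lambda> D k lam \<longleftrightarrow>
    (\<exists>u. (\<forall>i<lattice_count \<Lambda> k. solution_on V D lam (u i) \<and> deg_lt_on V (Suc k) (poly_fun (u i))) \<and>
         lin_indep_mod V (lattice_count \<Lambda> k) u) \<and>
    (\<forall>u. solution_on V D lam u \<and> deg_lt_on V k (poly_fun u) \<longrightarrow> (\<forall>x\<in>V. poly_fun u x = 0))"
  (is "_ \<longleftrightarrow> ?E \<and> ?N")
proof -
  have N: "(\<forall>u. solution_on V D lam u \<and> class_degree V u < k \<longrightarrow> u \<in> vanishing_ideal V) \<longleftrightarrow> ?N"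
    by (cases "k = 0") (auto simp: class_degree_less_iff vanishing_ideal_def deg_lt_on_0)
  have "class_degree V (u i) = k \<longleftrightarrow> deg_lt_on V (Suc k) (poly_fun (u i))"
    if ?N "i < r" "solution_on V D lam (u i)" "lin_indep_mod V r u" for u i r
  proof
    assume "class_degree V (u i) = k"
    then show "deg_lt_on V (Suc k) (poly_fun (u i))"
      using class_degree_less_iff[of V "u i" "Suc k"] by simp
  next
    assume 1: "deg_lt_on V (Suc k) (poly_fun (u i))"
    have "\<not> (\<forall>x\<in>V. poly_fun (u i) x = 0)"
      using lin_indep_mod_nonzero[OF that(4,2)] by blast
    then have "\<not> class_degree V (u i) < k" using that(1,3) class_degree_less_iff by blast
    moreover have "class_degree V (u i) < Suc k" using 1 class_degree_less_iff by blast
    ultimately show "class_degree V (u i) = k" by simp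
  qed
  then show ?thesis unfolding admissible_at_def N by blast
qed

lemma admissible_at_eigenvalue:
  assumes "ideal_invariant V (diff_op A B)" "acts_on_layer V (diff_op A B) k e"
    "admissible_at V \<Lambda> (diff_op A B) k lam" "lattice_count \<Lambda> k > 0"
  shows "lam = e"
proof (rule ccontr)
  assume ne: "lam \<noteq> e"
  obtain u where u: "solution_on V (diff_op A B) lam (u 0)" "deg_lt_on V (Suc k) (poly_fun (u 0))"
    "lin_indep_mod V (lattice_count \<Lambda> k) u"
    using assms(3,4) unfolding admissible_at_iff by blast
  have "deg_lt_on V k (\<lambda>x. diff_op A B (poly_fun (u 0)) x - e * poly_fun (u 0) x)"
    by (rule acts_on_layer_on) (use assms u in auto)
  from deg_lt_on_cmult[OF this, of "1 / (lam - e)"]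
  have "deg_lt_on V k (poly_fun (u 0))"
    by (rule deg_lt_on_cong) (use u(1) ne in \<open>auto simp: solution_on_def field_simps\<close>)
  then have "\<forall>x\<in>V. poly_fun (u 0) x = 0"
    using assms(3) u(1) unfolding admissible_at_iff by blast
  then show False using lin_indep_mod_nonzero[OF u(3) assms(4)] by blast
qed

text \<open>\<open>D - lam\<close> is injective on polynomials of degree less than \<open>k\<close> if \<open>lam\<close> differs from the scalars of
  the nonzero layers below \<open>k\<close>.\<close>

lemma solution_on_unique:
  assumes "lattice_set V \<Lambda>" "ideal_invariant V (diff_op A B)"
    "\<And>j. acts_on_layer V (diff_op A B) j (e j)"
    "\<And>j. j < k \<Longrightarrow> lattice_count \<Lambda> j > 0 \<Longrightarrow> lam \<noteq> e j"
    "solution_on V (diff_op A B) lam u" "deg_lt_on V k (poly_fun u)"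
  shows "\<forall>x\<in>V. poly_fun u x = 0"
  using assms(4,6)
proof (induction k)
  case 0
  then show ?case by (simp add: deg_lt_on_0)
next
  case (Suc k)
  have "deg_lt_on V k (poly_fun u)"
  proof (cases "lattice_count \<Lambda> k = 0")
    case True
    then show ?thesis using lattice_layer_empty[OF assms(1)] Suc by blast
  next
    case False
    then have ne: "lam \<noteq> e k" using Suc by simp
    from deg_lt_on_cmult[OF acts_on_layer_on[OF assms(2,3) Suc.prems(2)], of "1 / (lam - e k)"]
    show ?thesis
      by (rule deg_lt_on_cong) (use assms(5) ne in \<open>auto simp: solution_on_def field_simps\<close>)
  qed
  then show ?case using Suc by simp
qed

text \<open>Under the same condition \<open>D - lam\<close> is surjective: dividing by \<open>e\<^sub>k - lam\<close> solves the equation up to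
  lower degree, and the remainder is treated by induction.\<close>

lemma shifted_operator_solvable:
  assumes "lattice_set V \<Lambda>" "ideal_invariant V (diff_op A B)"
    "\<And>j. acts_on_layer V (diff_op A B) j (e j)"
    "\<And>j. j < k \<Longrightarrow> lattice_count \<Lambda> j > 0 \<Longrightarrow> lam \<noteq> e j"
    "deg_lt_on V k w"
  shows "\<exists>v. deg_lt k v \<and> (\<forall>x\<in>V. diff_op A B v x - lam * v x = w x)"
  using assms(4,5)
proof (induction k arbitrary: w)
  case 0
  then show ?case by (intro exI[of _ "\<lambda>x. 0"]) (auto simp: deg_lt_on_0 intro: deg_lt_zero)
next
  case (Suc k)
  show ?case
  proof (cases "lattice_count \<Lambda> k = 0")
    case True
    then have "deg_lt_on V k w" using lattice_layer_empty[OF assms(1)] Suc by blast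
    then show ?thesis using Suc.IH[of w] Suc.prems(1) deg_lt_Suc by (metis less_SucI)
  next
    case False
    then have ne: "e k - lam \<noteq> 0" using Suc.prems(1)[of k] by simp
    obtain g where g: "deg_lt (Suc k) g" "\<And>x. x \<in> V \<Longrightarrow> w x = g x"
      using Suc.prems(2) unfolding deg_lt_on_def by blast
    define v0 where "v0 = (\<lambda>x. 1 / (e k - lam) * g x)"
    have v0: "deg_lt (Suc k) v0" unfolding v0_def by (rule deg_lt_cmult[OF g(1)])
    then have "deg_lt_on V k (\<lambda>x. diff_op A B v0 x - e k * v0 x)"
      using assms(3) unfolding acts_on_layer_def by blast
    then have "deg_lt_on V k (\<lambda>x. diff_op A B v0 x - lam * v0 x - w x)"
      by (rule deg_lt_on_cong) (use g(2) ne in \<open>simp add: v0_def field_simps\<close>)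
    then obtain v1 where v1: "deg_lt k v1"
      "\<forall>x\<in>V. diff_op A B v1 x - lam * v1 x = diff_op A B v0 x - lam * v0 x - w x"
      using Suc.IH Suc.prems(1) less_SucI by blast
    have "deg_lt (Suc k) (\<lambda>x. v0 x + (- 1) * v1 x)"
      by (intro deg_lt_add v0 deg_lt_cmult deg_lt_Suc v1(1))
    then show ?thesis using v1(2)
      by (intro exI[of _ "\<lambda>x. v0 x - v1 x"]) (auto simp: diff_op_diff algebra_simps)
  qed
qed

lemma admissible_atI:
  assumes "lattice_set V \<Lambda>" "ideal_invariant V (diff_op A B)"
    "\<And>j. acts_on_layer V (diff_op A B) j (e j)"
    "\<And>j. j < k \<Longrightarrow> lattice_count \<Lambda> j > 0 \<Longrightarrow> lam \<noteq> e j"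
    "lattice_count \<Lambda> k > 0 \<Longrightarrow> lam = e k"
  shows "admissible_at V \<Lambda> (diff_op A B) k lam"
proof -
  have fin: "finite {\<mu> \<in> \<Lambda>. mdeg \<mu> = k}"
    by (rule finite_subset[OF _ finite_mdeg_eq[of k]]) auto
  obtain h where h: "bij_betw h {..<lattice_count \<Lambda> k} {\<mu> \<in> \<Lambda>. mdeg \<mu> = k}"
    using ex_bij_betw_nat_finite[OF fin] unfolding lattice_count_def atLeast0LessThan by blast
  have hk: "h i \<in> \<Lambda>" "mdeg (h i) = k" if "i < lattice_count \<Lambda> k" for i
    using bij_betwE[OF h] that by auto
  have "\<exists>u. solution_on V (diff_op A B) lam u \<and>
      deg_lt k (\<lambda>x. poly_fun u x - mpow x (h i))" if "i < lattice_count \<Lambda> k" for i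
  proof -
    have m: "deg_lt (Suc k) (\<lambda>x. mpow x (h i))"
      using deg_lt_monomial[of "h i" 1] hk[OF that] by simp
    have "lam = e k" using assms(5) that by simp
    then have "deg_lt_on V k (\<lambda>x. diff_op A B (\<lambda>x. mpow x (h i)) x - lam * mpow x (h i))"
      using assms(3) m unfolding acts_on_layer_def by blast
    then obtain v where v: "deg_lt k v" "\<forall>x\<in>V. diff_op A B v x - lam * v x
        = diff_op A B (\<lambda>x. mpow x (h i)) x - lam * mpow x (h i)"
      using shifted_operator_solvable[OF assms(1-4)] by blast
    have nv: "deg_lt k (\<lambda>x. (- 1) * v x)" by (rule deg_lt_cmult[OF v(1)])
    have "deg_lt (Suc k) (\<lambda>x. mpow x (h i) + (- 1) * v x)"
      by (rule deg_lt_add[OF m deg_lt_Suc[OF nv]])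
    from deg_lt_imp_poly_fun[OF this]
    obtain u where u: "poly_fun u = (\<lambda>x. mpow x (h i) - v x)" by auto
    have "solution_on V (diff_op A B) lam u"
      using v(2) by (auto simp: solution_on_def u diff_op_diff algebra_simps)
    then show ?thesis using nv by (intro exI[of _ u]) (simp add: u)
  qed
  then have "\<forall>i\<in>{..<lattice_count \<Lambda> k}. \<exists>u. solution_on V (diff_op A B) lam u \<and>
      deg_lt k (\<lambda>x. poly_fun u x - mpow x (h i))" by simp
  from bchoice[OF this] obtain u where
    u: "\<And>i. i < lattice_count \<Lambda> k \<Longrightarrow> solution_on V (diff_op A B) lam (u i)"
    "\<And>i. i < lattice_count \<Lambda> k \<Longrightarrow> deg_lt k (\<lambda>x. poly_fun (u i) x - mpow x (h i))"
    by auto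
  have "deg_lt_on V (Suc k) (poly_fun (u i))" if "i < lattice_count \<Lambda> k" for i
  proof -
    have "deg_lt (Suc k) (\<lambda>x. (poly_fun (u i) x - mpow x (h i)) + 1 * mpow x (h i))"
      using deg_lt_monomial[of "h i" 1] hk[OF that]
      by (intro deg_lt_add deg_lt_Suc[OF u(2)[OF that]]) simp
    then show ?thesis using deg_lt_imp_on by simp
  qed
  moreover have "lin_indep_mod V (lattice_count \<Lambda> k) u"
    unfolding lin_indep_mod_iff
  proof (intro allI impI)
    fix c i assume c: "\<forall>x\<in>V. (\<Sum>i<lattice_count \<Lambda> k. c i * poly_fun (u i) x) = 0"
      and i: "i < lattice_count \<Lambda> k"
    define p where "p = (\<Sum>i<lattice_count \<Lambda> k. Poly_Mapping.single (h i) (c i))"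
    have "deg_lt_on V k (\<lambda>x. \<Sum>i<lattice_count \<Lambda> k. c i * (poly_fun (u i) x - mpow x (h i)))"
      using u(2) by (intro deg_lt_on_sum deg_lt_on_cmult deg_lt_imp_on) simp
    from deg_lt_on_cmult[OF this, of "- 1"]
    have "deg_lt_on V k (poly_fun p)"
      by (rule deg_lt_on_cong)
        (use c in \<open>simp add: p_def poly_fun_sum poly_fun_single right_diff_distrib sum_subtractf\<close>)
    moreover have "Poly_Mapping.keys p \<subseteq> \<Lambda>"
    proof -
      have "Poly_Mapping.keys p \<subseteq> (\<Union>i<lattice_count \<Lambda> k. Poly_Mapping.keys (Poly_Mapping.single (h i) (c i)))"
        unfolding p_def by (rule keys_sum)
      also have "\<dots> \<subseteq> \<Lambda>" using hk by (auto split: if_splits)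
      finally show ?thesis .
    qed
    ultimately have "h i \<notin> Poly_Mapping.keys p"
      using lattice_keys_less[OF assms(1)] hk[OF i] by blast
    moreover have "Poly_Mapping.lookup p (h i) = c i"
    proof -
      have "Poly_Mapping.lookup p (h i) = (\<Sum>j<lattice_count \<Lambda> k. if j = i then c i else 0)"
        unfolding p_def lookup_sum
        using bij_betw_imp_inj_on[OF h] i
        by (intro sum.cong) (auto simp: lookup_single when_def inj_on_def)
      then show ?thesis using i by simp
    qed
    ultimately show "c i = 0" by (simp add: in_keys_iff)
  qed
  moreover have "\<forall>x\<in>V. poly_fun u x = 0"
    if "solution_on V (diff_op A B) lam u" "deg_lt_on V k (poly_fun u)" for u
    using solution_on_unique[OF assms(1-4)] that by blast
  ultimately show ?thesis unfolding admissible_at_iff using u(1) by blast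
qed

lemma admissible_imp_acts_on_layer:
  assumes "lattice_set V \<Lambda>" "ideal_invariant V (diff_op A B)"
    "\<And>k. admissible_at V \<Lambda> (diff_op A B) k (e k)"
  shows "acts_on_layer V (diff_op A B) k (e k)"
proof (induction k rule: less_induct)
  case (less k)
  \<comment> \<open>In terms of the normal forms \<open>c i\<close> of the solutions, the claim that they span the layer is a
    square linear system for the coefficients at the monomials in \<open>M\<close>.\<close>
  define r where "r = lattice_count \<Lambda> k"
  define M where "M = {\<mu> \<in> \<Lambda>. mdeg \<mu> = k}"
  have fin: "finite M" unfolding M_def
    by (rule finite_subset[OF _ finite_mdeg_eq[of k]]) auto
  have card: "card M = r" by (simp add: M_def r_def lattice_count_def)
  obtain u where u: "\<And>i. i < r \<Longrightarrow> solution_on V (diff_op A B) (e k) (u i)"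
    "\<And>i. i < r \<Longrightarrow> deg_lt_on V (Suc k) (poly_fun (u i))" "lin_indep_mod V r u"
    using assms(3)[of k] unfolding admissible_at_iff r_def by blast
  have zero: "\<forall>x\<in>V. poly_fun v x = 0"
    if "solution_on V (diff_op A B) (e k) v" "deg_lt_on V k (poly_fun v)" for v
    using assms(3)[of k] that unfolding admissible_at_iff by blast
  have "\<exists>c. Poly_Mapping.keys c \<subseteq> {\<mu> \<in> \<Lambda>. mdeg \<mu> < Suc k} \<and> (\<forall>x\<in>V. poly_fun (u i) x = poly_fun c x)"
    if "i < r" for i
    using lattice_normal_form[OF assms(1) u(2)[OF that]] by metis
  then obtain c where c: "\<And>i. i < r \<Longrightarrow> Poly_Mapping.keys (c i) \<subseteq> {\<mu> \<in> \<Lambda>. mdeg \<mu> < Suc k}"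
    "\<And>i x. i < r \<Longrightarrow> x \<in> V \<Longrightarrow> poly_fun (u i) x = poly_fun (c i) x" by metis
  have low: "deg_lt k (poly_fun p)"
    if "Poly_Mapping.keys p \<subseteq> {\<mu> \<in> \<Lambda>. mdeg \<mu> < Suc k}" "\<And>\<mu>. \<mu> \<in> M \<Longrightarrow> Poly_Mapping.lookup p \<mu> = 0" for p
  proof (rule deg_lt_poly_fun)
    fix \<mu> assume m: "\<mu> \<in> Poly_Mapping.keys p"
    then have "\<mu> \<notin> M" using that(2) by (auto simp: in_keys_iff)
    then show "mdeg \<mu> < k" using that(1) m by (auto simp: M_def less_Suc_eq)
  qed
  define comb where "comb = (\<lambda>d. \<Sum>i<r. Poly_Mapping.single 0 (d i) * c i)"
  have lookup_comb: "Poly_Mapping.lookup (comb d) \<mu> = (\<Sum>i<r. d i * Poly_Mapping.lookup (c i) \<mu>)" for d \<mu>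
    by (simp add: comb_def lookup_sum lookup_const_mult)
  have keys_comb: "Poly_Mapping.keys (comb d) \<subseteq> {\<mu> \<in> \<Lambda>. mdeg \<mu> < Suc k}" for d
  proof
    fix \<mu> assume "\<mu> \<in> Poly_Mapping.keys (comb d)"
    then have "(\<Sum>i<r. d i * Poly_Mapping.lookup (c i) \<mu>) \<noteq> 0" by (simp add: in_keys_iff lookup_comb)
    then obtain i where "i < r" "Poly_Mapping.lookup (c i) \<mu> \<noteq> 0"
      by (metis (no_types, lifting) lessThan_iff mult_zero_right sum.neutral)
    then show "\<mu> \<in> {\<mu> \<in> \<Lambda>. mdeg \<mu> < Suc k}" using c(1)[of i] by (auto simp: in_keys_iff)
  qed
  have poly_comb: "poly_fun (comb d) x = (\<Sum>i<r. d i * poly_fun (c i) x)" for d x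
    by (simp add: comb_def poly_fun_lincomb)
  have D_comb: "diff_op A B (poly_fun (comb d)) x = e k * poly_fun (comb d) x" if x: "x \<in> V" for d x
  proof -
    have "diff_op A B (poly_fun (c i)) x = e k * poly_fun (c i) x" if i: "i < r" for i
    proof -
      obtain n m where "deg_lt n (poly_fun (u i))" "deg_lt m (poly_fun (c i))"
        using deg_lt_poly_fun_ex by metis
      then have "diff_op A B (poly_fun (u i)) x = diff_op A B (poly_fun (c i)) x"
        using ideal_invariant_cong[OF assms(2)] c(2)[OF i] x by blast
      then show ?thesis using u(1)[OF i] x c(2)[OF i x] by (simp add: solution_on_def)
    qed
    then show ?thesis
      unfolding poly_comb[abs_def] diff_op_sum by (simp add: sum_distrib_left algebra_simps)
  qed
  have inj: "\<forall>i<card M. d i = 0"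
    if "\<And>\<mu>. \<mu> \<in> M \<Longrightarrow> (\<Sum>i<card M. d i * Poly_Mapping.lookup (c i) \<mu>) = 0" for d
  proof -
    have "deg_lt_on V k (poly_fun (comb d))"
      by (intro deg_lt_imp_on low keys_comb) (use that in \<open>simp add: lookup_comb card\<close>)
    then have "\<forall>x\<in>V. poly_fun (comb d) x = 0"
      using zero D_comb unfolding solution_on_def by blast
    then have "\<forall>x\<in>V. (\<Sum>i<r. d i * poly_fun (u i) x) = 0"
      by (simp add: poly_comb c(2))
    then show ?thesis using u(3) unfolding lin_indep_mod_iff card by blast
  qed
  show ?case
    unfolding acts_on_layer_def
  proof (intro allI impI)
    fix f :: "real ^ 'a \<Rightarrow> real" assume f: "deg_lt (Suc k) f"
    obtain p where p: "Poly_Mapping.keys p \<subseteq> {\<mu> \<in> \<Lambda>. mdeg \<mu> < Suc k}"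
      "\<And>x. x \<in> V \<Longrightarrow> f x = poly_fun p x"
      using lattice_normal_form[OF assms(1) deg_lt_imp_on[OF f]] by blast
    obtain d where d: "\<And>\<mu>. \<mu> \<in> M \<Longrightarrow> (\<Sum>i<card M. d i * Poly_Mapping.lookup (c i) \<mu>) = Poly_Mapping.lookup p \<mu>"
      using square_system_solvable[OF fin, of "\<lambda>i. Poly_Mapping.lookup (c i)" "Poly_Mapping.lookup p"] inj
      by blast
    define g where "g = poly_fun (p - comb d)"
    have g: "deg_lt k g" unfolding g_def
    proof (rule low)
      show "Poly_Mapping.keys (p - comb d) \<subseteq> {\<mu> \<in> \<Lambda>. mdeg \<mu> < Suc k}"
        using keys_diff[of p "comb d"] p(1) keys_comb[of d] by blast
    qed (use d in \<open>simp add: lookup_minus lookup_comb card\<close>)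
    have gs: "deg_lt_on V k (\<lambda>x. diff_op A B g x - e k * g x)"
    proof (cases k)
      case 0
      then have "g = (\<lambda>x. 0)" using g deg_lt_0D by blast
      then show ?thesis by (simp add: deg_lt_on_zero)
    next
      case (Suc j)
      then have "deg_lt_on V j (\<lambda>x. diff_op A B g x - e j * g x)"
        using less[of j] g unfolding acts_on_layer_def by blast
      then have "deg_lt_on V k (\<lambda>x. (diff_op A B g x - e j * g x) + (e j - e k) * g x)"
        using deg_lt_on_mono[of V j _ k] deg_lt_imp_on[OF g] Suc
        by (intro deg_lt_on_add deg_lt_on_cmult) auto
      then show ?thesis by (rule deg_lt_on_cong) (simp add: algebra_simps)
    qed
    have fg: "poly_fun p = (\<lambda>x. g x + poly_fun (comb d) x)"
      by (auto simp: g_def poly_fun_minus)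
    obtain n where n: "deg_lt n (poly_fun p)" using deg_lt_poly_fun_ex by blast
    show "deg_lt_on V k (\<lambda>x. diff_op A B f x - e k * f x)"
    proof (rule deg_lt_on_cong[OF gs])
      fix x assume x: "x \<in> V"
      have "diff_op A B f x = diff_op A B (poly_fun p) x"
        using ideal_invariant_cong[OF assms(2) f n p(2) x] .
      also have "\<dots> = diff_op A B g x + e k * poly_fun (comb d) x"
        unfolding fg diff_op_add D_comb[OF x] ..
      finally show "diff_op A B g x - e k * g x = diff_op A B f x - e k * f x"
        using p(2)[OF x] by (simp add: fg algebra_simps)
    qed
  qed
qed

section \<open>The coefficients of an admissible operator\<close>

lemma fwd_diff_axis: "fwd_diff j (\<lambda>x. x $ i) x = of_bool (j = i)"
  by (auto simp: fwd_diff_def axis_def)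

lemma bwd_diff_axis: "bwd_diff j (\<lambda>x. x $ i) = (\<lambda>x. of_bool (j = i))"
  by (auto simp: bwd_diff_def axis_def)

lemma fwd_diff_const [simp]: "fwd_diff j (\<lambda>x. c) x = 0"
  by (simp add: fwd_diff_def)

lemma bwd_diff_const [simp]: "bwd_diff j (\<lambda>x. c) x = 0"
  by (simp add: bwd_diff_def)

lemma diff_op_degree1: "diff_op A B (\<lambda>x. x $ i) x = B i x"
  using diff_op_coord[of A B i "\<lambda>x. 1" x] by (simp add: bwd_diff_const[abs_def])

lemma diff_op_degree2:
  "diff_op A B (\<lambda>x. x $ i * x $ j) x =
     x $ i * B j x + (A i j x + A j i x) + B i x * x $ j + of_bool (i = j) * B i x"
proof -
  have "(\<Sum>p\<in>UNIV. (A i p x + A p i x) * fwd_diff p (\<lambda>x. x $ j) x)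
    = (\<Sum>p\<in>UNIV. if p = j then A i j x + A j i x else 0)"
    by (rule sum.cong) (auto simp: fwd_diff_axis)
  then show ?thesis
    unfolding diff_op_coord[of A B i "\<lambda>x. x $ j" x] diff_op_degree1 bwd_diff_axis
    by (simp add: fwd_diff_axis)
qed

text \<open>This monomial separates \<open>A\<^sub>i\<^sub>j\<close> from \<open>A\<^sub>j\<^sub>i\<close>, because \<open>\<triangle>\<^sub>i \<nabla>\<^sub>j\<close> and \<open>\<triangle>\<^sub>j \<nabla>\<^sub>i\<close> map it to
  \<open>2 x\<^sub>i + 1\<close> and \<open>2 x\<^sub>i - 1\<close>.\<close>

lemma diff_op_degree3:
  assumes "i \<noteq> j"
  shows "diff_op A B (\<lambda>x. x $ i * (x $ i * x $ j)) x =
     x $ i * diff_op A B (\<lambda>x. x $ i * x $ j) x + 2 * A i i x * x $ j + (A i j x + A j i x) * x $ i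
     + B i x * (x $ i * x $ j) + (A i j x - A j i x + B i x * x $ j)"
proof -
  have F: "fwd_diff p (\<lambda>x. x $ i * x $ j) x = of_bool (p = i) * x $ j + of_bool (p = j) * x $ i" for p
    using assms by (auto simp: fwd_diff_def axis_def algebra_simps)
  have FB: "fwd_diff p (bwd_diff q (\<lambda>x. x $ i * x $ j)) x =
     of_bool (p = i) * of_bool (q = j) + of_bool (p = j) * of_bool (q = i)" for p q
    using assms by (auto simp: fwd_diff_def bwd_diff_def axis_def algebra_simps)
  have 1: "(\<Sum>p\<in>UNIV. (A i p x + A p i x) * fwd_diff p (\<lambda>x. x $ i * x $ j) x)
    = 2 * A i i x * x $ j + (A i j x + A j i x) * x $ i"
  proof -
    have "(\<Sum>p\<in>UNIV. (A i p x + A p i x) * fwd_diff p (\<lambda>x. x $ i * x $ j) x)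
      = (\<Sum>p\<in>UNIV. (if p = i then 2 * A i i x * x $ j else 0)
          + (if p = j then (A i j x + A j i x) * x $ i else 0))"
      by (rule sum.cong) (auto simp: F algebra_simps)
    then show ?thesis by (simp add: sum.distrib)
  qed
  have 2: "(\<Sum>p\<in>UNIV. A i p x * (fwd_diff i (bwd_diff p (\<lambda>x. x $ i * x $ j)) x
       - fwd_diff p (bwd_diff p (\<lambda>x. x $ i * x $ j)) x)) = A i j x"
  proof -
    have "(\<Sum>p\<in>UNIV. A i p x * (fwd_diff i (bwd_diff p (\<lambda>x. x $ i * x $ j)) x
       - fwd_diff p (bwd_diff p (\<lambda>x. x $ i * x $ j)) x)) = (\<Sum>p\<in>UNIV. if p = j then A i j x else 0)"
      using assms by (intro sum.cong) (auto simp: FB)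
    then show ?thesis by simp
  qed
  have 3: "(\<Sum>p\<in>UNIV. A p i x * fwd_diff p (bwd_diff i (\<lambda>x. x $ i * x $ j)) x) = A j i x"
  proof -
    have "(\<Sum>p\<in>UNIV. A p i x * fwd_diff p (bwd_diff i (\<lambda>x. x $ i * x $ j)) x)
      = (\<Sum>p\<in>UNIV. if p = j then A j i x else 0)"
      using assms by (intro sum.cong) (auto simp: FB)
    then show ?thesis by simp
  qed
  show ?thesis
    unfolding diff_op_coord[of A B i "\<lambda>x. x $ i * x $ j" x] 1 2 3 unfolding F using assms by simp
qed

text \<open>The cubics \<open>x\<^sub>i\<^sup>2 x\<^sub>j\<close> and \<open>x\<^sub>j\<^sup>2 x\<^sub>i\<close> are distinct lattice monomials, so no nonzero multiple of their
  sum agrees on \<open>V\<close> with a polynomial of degree at most 2.\<close>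

lemma cubic_leading_coeff_zero:
  assumes "lattice_set V \<Lambda>" "\<forall>\<mu>. mdeg \<mu> = 3 \<longrightarrow> \<mu> \<in> \<Lambda>" "i \<noteq> j"
    "deg_lt_on V 3 (\<lambda>x. c * (x $ i * (x $ i * x $ j)) + c * (x $ j * (x $ j * x $ i)))"
  shows "c = 0"
proof (rule ccontr)
  assume c: "c \<noteq> 0"
  define m where "m = (\<lambda>i j :: 'a. Poly_Mapping.single i (2::nat) + Poly_Mapping.single j 1)"
  define p where "p = Poly_Mapping.single (m i j) c + Poly_Mapping.single (m j i) c"
  have m3: "mdeg (m i j) = 3" for i j by (simp add: m_def mdeg_add)
  have "Poly_Mapping.lookup (m i j) i = 2" "Poly_Mapping.lookup (m j i) i = 1"
    using assms(3) by (auto simp: m_def lookup_add lookup_single when_def)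
  then have "m j i \<noteq> m i j" by auto
  then have key: "m i j \<in> Poly_Mapping.keys p"
    using c by (simp add: p_def in_keys_iff lookup_add lookup_single when_def)
  have "Poly_Mapping.keys p \<subseteq> {m i j, m j i}"
    unfolding p_def by (rule order_trans[OF keys_add]) auto
  then have sub: "Poly_Mapping.keys p \<subseteq> \<Lambda>" using assms(2) m3 by auto
  have "deg_lt_on V 3 (poly_fun p)"
    by (rule deg_lt_on_cong[OF assms(4)])
      (simp add: p_def m_def poly_fun_add poly_fun_single mpow_add mpow_single power2_eq_square)
  from lattice_keys_less[OF assms(1) sub this key] m3 show False by simp
qed

text \<open>The constants are read off from \<open>e\<^sub>1 = b\<close> and \<open>e\<^sub>2 = 2 (a + b)\<close>.\<close>

lemma acts_on_layer_imp_coeff_conditions: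
  assumes "lattice_set V \<Lambda>" "\<forall>\<mu>. mdeg \<mu> = 3 \<longrightarrow> \<mu> \<in> \<Lambda>"
    "\<And>k. acts_on_layer V (diff_op A B) k (e k)"
  shows "coeff_conditions V A B (e 2 / 2 - e 1) (e 1)"
proof -
  define a where "a = e 2 / 2 - e 1"
  have c1: "deg_lt (Suc (Suc 0)) (\<lambda>x. x $ i)" for i :: 'a
    using deg_lt_coord[OF deg_lt_const[of 0 1], of i] by simp
  have c2: "deg_lt (Suc (Suc (Suc 0))) (\<lambda>x. x $ i * x $ j)" for i j :: 'a
    by (intro deg_lt_coord c1)
  have c3: "deg_lt (Suc (Suc (Suc (Suc 0)))) (\<lambda>x. x $ l * (x $ i * x $ j))" for l i j :: 'a
    by (intro deg_lt_coord c1)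
  have B1: "deg_lt_on V 1 (\<lambda>x. B i x - e 1 * x $ i)" for i
    using assms(3)[of 1] c1[of i] unfolding acts_on_layer_def
    by (auto simp flip: diff_op_degree1[of A B])
  have B2: "deg_lt_on V 2 (B i)" for i
  proof -
    have "deg_lt_on V 2 (\<lambda>x. (B i x - e 1 * x $ i) + e 1 * x $ i)"
      using c1[of i] by (intro deg_lt_on_add deg_lt_on_cmult deg_lt_on_mono[OF B1] deg_lt_imp_on)
        (simp_all add: numeral_2_eq_2)
    then show ?thesis by simp
  qed
  have D2: "deg_lt_on V 2 (\<lambda>x. diff_op A B (\<lambda>x. x $ i * x $ j) x - e 2 * (x $ i * x $ j))" for i j
    using assms(3)[of 2] c2[of i j] unfolding acts_on_layer_def by (simp add: numeral_2_eq_2)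
  have D3: "deg_lt_on V 3 (\<lambda>x. diff_op A B (\<lambda>x. x $ l * (x $ i * x $ j)) x - e 3 * (x $ l * (x $ i * x $ j)))" for l i j
    using assms(3)[of 3] c3[of l i j] unfolding acts_on_layer_def by (simp add: numeral_3_eq_3)
  have coord: "deg_lt_on V n f \<Longrightarrow> Suc n = m \<Longrightarrow> deg_lt_on V m (\<lambda>x. x $ i * f x)" for n m f and i :: 'a
    using deg_lt_on_coord by blast
  have S: "deg_lt_on V 2 (\<lambda>x. A i j x + A j i x - 2 * a * (x $ i * x $ j))" for i j
  proof -
    have "deg_lt_on V 2 (\<lambda>x. (diff_op A B (\<lambda>x. x $ i * x $ j) x - e 2 * (x $ i * x $ j))
      - x $ i * (B j x - e 1 * x $ j) - x $ j * (B i x - e 1 * x $ i) - of_bool (i = j) * B i x)"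
      by (intro deg_lt_on_diff D2 coord[OF B1] deg_lt_on_cmult B2) auto
    then show ?thesis
      by (rule deg_lt_on_cong) (simp add: diff_op_degree2 a_def algebra_simps)
  qed
  have S3: "deg_lt_on V 3 (\<lambda>x. A i j x + A j i x)" for i j
  proof -
    have "deg_lt_on V 3 (\<lambda>x. (A i j x + A j i x - 2 * a * (x $ i * x $ j)) + 2 * a * (x $ i * x $ j))"
      using c2[of i j] by (intro deg_lt_on_add deg_lt_on_cmult deg_lt_on_mono[OF S] deg_lt_imp_on)
        (simp_all add: numeral_3_eq_3)
    then show ?thesis by simp
  qed
  \<comment> \<open>\<open>6 a + 3 b\<close> is the value of \<open>e\<^sub>3\<close> predicted by the degrees 1 and 2; \<open>c\<close> turns out to be 0 if
    there are two distinct indices.\<close>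
  define c where "c = e 3 - 6 * a - 3 * e 1"
  have T: "deg_lt_on V 3 (\<lambda>x. A i j x - A j i x - c * (x $ i * (x $ i * x $ j)))" if "i \<noteq> j" for i j
  proof -
    have "deg_lt_on V 3 (\<lambda>x.
        (diff_op A B (\<lambda>x. x $ i * (x $ i * x $ j)) x - e 3 * (x $ i * (x $ i * x $ j)))
      - x $ i * (diff_op A B (\<lambda>x. x $ i * x $ j) x - e 2 * (x $ i * x $ j))
      - x $ j * (A i i x + A i i x - 2 * a * (x $ i * x $ i))
      - x $ i * (A i j x + A j i x - 2 * a * (x $ i * x $ j))
      - x $ i * (x $ j * (B i x - e 1 * x $ i)) - x $ j * B i x)"
      by (intro deg_lt_on_diff D3 coord[OF D2] coord[OF S] coord[OF coord[OF B1 refl]] coord[OF B2])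
        auto
    then show ?thesis
      by (rule deg_lt_on_cong)
        (simp add: diff_op_degree3[OF that] c_def a_def algebra_simps)
  qed
  have A3: "deg_lt_on V 3 (A i j)" for i j
  proof (cases "i = j")
    case True
    from deg_lt_on_cmult[OF S3[of i i], of "1 / 2"] show ?thesis
      by (rule deg_lt_on_cong) (simp add: True)
  next
    case False
    have "deg_lt_on V 3 (\<lambda>x. (- 1) * ((A i j x - A j i x - c * (x $ i * (x $ i * x $ j)))
       + (A j i x - A i j x - c * (x $ j * (x $ j * x $ i)))))"
      using False by (intro deg_lt_on_cmult deg_lt_on_add T) auto
    then have "deg_lt_on V 3 (\<lambda>x. c * (x $ i * (x $ i * x $ j)) + c * (x $ j * (x $ j * x $ i)))"
      by (rule deg_lt_on_cong) (simp add: algebra_simps)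
    then have c: "c = 0" by (rule cubic_leading_coeff_zero[OF assms(1,2) False])
    have "deg_lt_on V 3 (\<lambda>x. 1 / 2 * ((A i j x + A j i x)
        + (A i j x - A j i x - c * (x $ i * (x $ i * x $ j)))))"
      by (intro deg_lt_on_cmult deg_lt_on_add S3 T False)
    then show ?thesis by (rule deg_lt_on_cong) (simp add: c)
  qed
  have "deg_lt_on V 2 (\<lambda>x. A i i x - a * (x $ i)\<^sup>2)" for i
    using deg_lt_on_cmult[OF S[of i i], of "1 / 2"]
    by (rule deg_lt_on_cong) (simp add: power2_eq_square algebra_simps)
  then show ?thesis
    unfolding coeff_conditions_def poly_on_iff cong_on_iff a_def[symmetric]
    using A3 B1 B2 S by (auto simp: numeral_2_eq_2 numeral_3_eq_3 mult.assoc)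
qed

section \<open>Characterization of admissible operators\<close>

theorem theorem3p7:
  fixes V :: "(real ^ ('d::finite)) set"
    and \<Lambda> :: "'d multi_index set"
    and A :: "'d \<Rightarrow> 'd \<Rightarrow> real ^ 'd \<Rightarrow> real"
    and B :: "'d \<Rightarrow> real ^ 'd \<Rightarrow> real"
  assumes "countable V" and "discrete V"
    and "lattice_set V \<Lambda>"
    and "\<forall>\<mu>. mdeg \<mu> \<in> {1, 2, 3} \<longrightarrow> \<mu> \<in> \<Lambda>"
    and "ideal_invariant V (diff_op A B)"
  shows "(admissible V \<Lambda> (diff_op A B) \<longleftrightarrow>
           (\<exists>a b. coeff_conditions V A B a b \<and>
                  inj_on (eigenvalue a b) {k. lattice_count \<Lambda> k > 0}))
       \<and> (\<forall>a b lam. coeff_conditions V A B a b \<and>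
                    (\<forall>k. admissible_at V \<Lambda> (diff_op A B) k (lam k)) \<longrightarrow>
            (\<forall>k. lattice_count \<Lambda> k > 0 \<longrightarrow> lam k = eigenvalue a b k))"
proof -
  note lat = assms(3) and inv = assms(5)
  have deg3: "\<forall>\<mu>. mdeg \<mu> = 3 \<longrightarrow> \<mu> \<in> \<Lambda>" using assms(4) by simp
  have ev: "lam k = eigenvalue a b k"
    if "coeff_conditions V A B a b" "\<forall>k. admissible_at V \<Lambda> (diff_op A B) k (lam k)"
      "lattice_count \<Lambda> k > 0" for a b lam k
    using admissible_at_eigenvalue[OF inv coeff_conditions_imp_acts_on_layer[OF that(1)] _ that(3)] that(2)
    by blast
  have "\<exists>a b. coeff_conditions V A B a b \<and> inj_on (eigenvalue a b) {k. lattice_count \<Lambda> k > 0}"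
    if adm: "admissible V \<Lambda> (diff_op A B)"
  proof -
    obtain e where e: "\<And>k. admissible_at V \<Lambda> (diff_op A B) k (e k)"
      using choice[OF adm[unfolded admissible_def]] by blast
    define a b where "a = e 2 / 2 - e 1" and "b = e 1"
    have co: "coeff_conditions V A B a b"
      unfolding a_def b_def
      by (rule acts_on_layer_imp_coeff_conditions[OF lat deg3])
        (rule admissible_imp_acts_on_layer[OF lat inv e])
    have ne: "eigenvalue a b j \<noteq> eigenvalue a b k"
      if jk: "lattice_count \<Lambda> j > 0" "lattice_count \<Lambda> k > 0" "j < k" for j k
    proof
      assume "eigenvalue a b j = eigenvalue a b k"
      then have eq: "e j = e k" using ev[OF co] e jk by metis
      obtain u where u: "solution_on V (diff_op A B) (e j) (u 0)"
        "deg_lt_on V (Suc j) (poly_fun (u 0))" "lin_indep_mod V (lattice_count \<Lambda> j) u"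
        using e[of j] jk(1) unfolding admissible_at_iff by blast
      have "deg_lt_on V k (poly_fun (u 0))" using deg_lt_on_mono[OF u(2)] jk(3) by simp
      then have "\<forall>x\<in>V. poly_fun (u 0) x = 0"
        using e[of k] u(1) eq unfolding admissible_at_iff by auto
      then show False using lin_indep_mod_nonzero[OF u(3) jk(1)] by blast
    qed
    have "inj_on (eigenvalue a b) {k. lattice_count \<Lambda> k > 0}"
      by (rule linorder_inj_onI) (use ne in auto)
    then show ?thesis using co by blast
  qed
  moreover have "admissible V \<Lambda> (diff_op A B)"
    if co: "coeff_conditions V A B a b" and inj: "inj_on (eigenvalue a b) {k. lattice_count \<Lambda> k > 0}" for a b
    unfolding admissible_def
  proof
    fix k
    show "\<exists>lam. admissible_at V \<Lambda> (diff_op A B) k lam"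
    proof (cases "lattice_count \<Lambda> k > 0")
      case True
      have "admissible_at V \<Lambda> (diff_op A B) k (eigenvalue a b k)"
        by (rule admissible_atI[OF lat inv coeff_conditions_imp_acts_on_layer[OF co]])
          (use inj True in \<open>auto dest: inj_onD\<close>)
      then show ?thesis by blast
    next
      case False
      \<comment> \<open>An empty layer needs no solutions; any number avoiding the lower eigenvalues will do.\<close>
      obtain lam where "lam \<notin> eigenvalue a b ` {..<k}"
        using ex_new_if_finite[OF infinite_UNIV_char_0] by (metis finite_imageI finite_lessThan)
      then have "admissible_at V \<Lambda> (diff_op A B) k lam"
        by (intro admissible_atI[OF lat inv coeff_conditions_imp_acts_on_layer[OF co]])
          (use False in auto)
      then show ?thesis by blast
    qed
  qed
  ultimately show ?thesis using ev by blast
qed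

end
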